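(* Let $H$ be a separable complex Hilbert space, let $T \in B(H)$ be a quasidiagonal operator and let $P_1 \leq P_2 \leq \cdots$ be any filtration of $H$ which asymptotically commutes with $T$, i.e. $\|[P_n,T]\| \to 0$. Then the following statements hold: (1) $\|T\| = \lim_{n\to\infty}\|P_nTP_n\|$ and $\|T^{-1}\| = \lim_{n\to\infty}\|(P_nTP_n)^{-1}\|$ (where the norm of the inverse of a non-invertible operator is taken to be $\infty$). (2) If $T$ is invertible then $\mathrm{cond}(T) = \lim_{n\to\infty}\mathrm{cond}(P_nTP_n)$. (3) If $T$ has closed range, $\varepsilon > 0$ is strictly smaller than $\inf\{\lambda > 0 : \lambda^2 \in \sigma(T^*T)\}$, and $T^+$ (resp. $(P_nTP_n)_{\varepsilon}^+$) denotes the Moore-Penrose inverse of $T$ (resp. of $(P_nTP_n)_{\varepsilon}$), then the generalized condition numbers of $(P_nTP_n)_\varepsilon$ converge to that of $T$: $$\|T\|\,\|T^+\| = \lim_{n\to\infty}\|(P_nTP_n)_{\varepsilon}\|\,\|(P_nTP_n)_{\varepsilon}^+\|.$$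
   Context: A filtration of $H$ is a sequence of finite rank orthogonal projections $P_n = P_n^* = P_n^2$ with $P_nH \subset P_{n+1}H$ for all $n$ and $\|P_n v - v\| \to 0$ for all $v \in H$. $[P,T] = PT - TP$. An operator $T \in B(H)$ is quasidiagonal if there exist finite rank orthogonal projections $Q_n$ with $\|Q_n v - v\| \to 0$ for all $v \in H$ and $\|[T,Q_n]\| \to 0$. $P_nTP_n$ is regarded as an operator on the finite dimensional space $P_nH$ (i.e. as a matrix), and inverses and Moore-Penrose inverses of it are taken there. Convention: if an operator $X$ is not invertible then $\|X^{-1}\| = \infty$. For invertible $X$, $\mathrm{cond}(X) = \|X\|\|X^{-1}\|$. An operator $T$ is Moore-Penrose invertible (equivalently, has closed range) if there is a (necessarily unique) bounded operator $T^+$, its Moore-Penrose inverse, with $TT^+T = T$, $T^+TT^+ = T^+$, $(TT^+)^* = TT^+$ and $(T^+T)^* = T^+T$; its generalized condition number is $\|T\|\|T^+\|$. For a matrix $S \in M_k(\mathbb{C})$ with singular value decomposition $S = UDV$ ($U,V$ unitary, $D = \mathrm{diag}(\lambda_1,\ldots,\lambda_k)$ with $0 \le \lambda_1 \leq \cdots \leq \lambda_k$ the singular values of $S$) and $\varepsilon > 0$, the $\varepsilon$-regularization of $S$ is $S_{\varepsilon} = U D_{\varepsilon} V$, where $D_{\varepsilon}$ is obtained from $D$ by replacing every $\lambda_j \leq \varepsilon$ by $0$. The infimum of the empty set is $+\infty$. *)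

theory Defs
  imports "HOL-Analysis.Analysis"
begin

section \<open>Complex Hilbert spaces\<close>

text \<open>
  A complex Hilbert space is a complete real inner product space together with a complex scalar
  multiplication extending the real one and a complex inner product (conjugate-linear in the first
  argument) whose real part is the given real inner product.  In particular the norm is
  \<open>norm x = sqrt (Re (cinner x x))\<close>, and positive definiteness of \<open>cinner\<close> comes from
  \<^class>\<open>real_inner\<close>.
\<close>

class chilbert_space = real_inner + complete_space +
  fixes scaleC :: "complex \<Rightarrow> 'a \<Rightarrow> 'a" (infixr "*\<^sub>C" 75)
    and cinner :: "'a \<Rightarrow> 'a \<Rightarrow> complex"
  assumes scaleC_add_right: "a *\<^sub>C (x + y) = a *\<^sub>C x + a *\<^sub>C y"
    and scaleC_add_left: "(a + b) *\<^sub>C x = a *\<^sub>C x + b *\<^sub>C x"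
    and scaleC_scaleC: "a *\<^sub>C (b *\<^sub>C x) = (a * b) *\<^sub>C x"
    and scaleC_of_real: "complex_of_real r *\<^sub>C x = r *\<^sub>R x"
    and cinner_commute: "cinner x y = cnj (cinner y x)"
    and cinner_add_right: "cinner x (y + z) = cinner x y + cinner x z"
    and cinner_scaleC_right: "cinner x (c *\<^sub>C y) = c * cinner x y"
    and Re_cinner: "Re (cinner x y) = x \<bullet> y"

global_interpretation complex_vector: vector_space "scaleC :: complex \<Rightarrow> 'a \<Rightarrow> 'a::chilbert_space"
  defines cspan = complex_vector.span
proof
  show "1 *\<^sub>C x = x" for x :: 'a
    using scaleC_of_real[of 1 x] by simp
qed (simp_all add: scaleC_add_right scaleC_add_left scaleC_scaleC)

instantiation complex :: chilbert_space
begin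

definition scaleC_complex :: "complex \<Rightarrow> complex \<Rightarrow> complex"
  where "scaleC_complex c x = c * x"

definition cinner_complex :: "complex \<Rightarrow> complex \<Rightarrow> complex"
  where "cinner_complex x y = cnj x * y"

instance
  by standard
    (simp_all add: scaleC_complex_def cinner_complex_def algebra_simps scaleR_conv_of_real
      inner_complex_def)

end


section \<open>Operators on a subspace\<close>

text \<open>
  Since the spaces \<open>P\<^sub>n H\<close> vary with \<open>n\<close>, operators on a closed subspace \<open>M\<close> of \<open>H\<close> are represented
  by functions of which only the values on \<open>M\<close> matter; all notions below are relative to \<open>M\<close>.
  Operators on \<open>H\<close> itself are the case \<open>M = UNIV\<close>.
\<close>

definition bounded_op_on :: "'a::chilbert_space set \<Rightarrow> ('a \<Rightarrow> 'a) \<Rightarrow> bool"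
  where "bounded_op_on M X \<longleftrightarrow>
    X ` M \<subseteq> M \<and>
    (\<forall>x\<in>M. \<forall>y\<in>M. X (x + y) = X x + X y) \<and>
    (\<forall>c. \<forall>x\<in>M. X (c *\<^sub>C x) = c *\<^sub>C X x) \<and>
    (\<exists>K. \<forall>x\<in>M. norm (X x) \<le> norm x * K)"

lemma bounded_op_on_UNIV:
  "bounded_op_on UNIV X \<longleftrightarrow> bounded_linear X \<and> (\<forall>c x. X (c *\<^sub>C x) = c *\<^sub>C X x)"
proof -
  have "X (r *\<^sub>R x) = r *\<^sub>R X x" if "\<forall>c x. X (c *\<^sub>C x) = c *\<^sub>C X x" for r x
    using that by (metis scaleC_of_real)
  then show ?thesis
    unfolding bounded_op_on_def bounded_linear_def bounded_linear_axioms_def linear_iff by auto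
qed

definition op_norm_on :: "'a::chilbert_space set \<Rightarrow> ('a \<Rightarrow> 'a) \<Rightarrow> real"
  where "op_norm_on M X = (SUP x\<in>M. norm (X x) / norm x)"

lemma op_norm_on_UNIV: "op_norm_on UNIV X = onorm X"
  by (simp add: op_norm_on_def onorm_def)

definition invertible_on :: "'a::chilbert_space set \<Rightarrow> ('a \<Rightarrow> 'a) \<Rightarrow> bool"
  where "invertible_on M X \<longleftrightarrow> (\<exists>Y. bounded_op_on M Y \<and> (\<forall>x\<in>M. X (Y x) = x \<and> Y (X x) = x))"

definition inv_norm_on :: "'a::chilbert_space set \<Rightarrow> ('a \<Rightarrow> 'a) \<Rightarrow> ereal"
  where "inv_norm_on M X = (if invertible_on M X then ereal (op_norm_on M (inv_into M X)) else \<infinity>)"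

text \<open>
  The value \<open>\<infinity>\<close> for non-invertible operators is stipulated separately, since in
  \<^typ>\<open>ereal\<close> the product \<open>0 * \<infinity>\<close> is \<open>0\<close>.
\<close>

definition cond_on :: "'a::chilbert_space set \<Rightarrow> ('a \<Rightarrow> 'a) \<Rightarrow> ereal"
  where "cond_on M X = (if invertible_on M X then ereal (op_norm_on M X) * inv_norm_on M X else \<infinity>)"

definition is_adjoint_on :: "'a::chilbert_space set \<Rightarrow> ('a \<Rightarrow> 'a) \<Rightarrow> ('a \<Rightarrow> 'a) \<Rightarrow> bool"
  where "is_adjoint_on M X Y \<longleftrightarrow> (\<forall>x\<in>M. \<forall>y\<in>M. cinner (X x) y = cinner x (Y y))"

abbreviation selfadjoint_on :: "'a::chilbert_space set \<Rightarrow> ('a \<Rightarrow> 'a) \<Rightarrow> bool"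
  where "selfadjoint_on M X \<equiv> is_adjoint_on M X X"

definition cadjoint :: "('a::chilbert_space \<Rightarrow> 'a) \<Rightarrow> 'a \<Rightarrow> 'a"
  where "cadjoint T = (THE S. is_adjoint_on UNIV T S)"

definition op_spectrum :: "('a::chilbert_space \<Rightarrow> 'a) \<Rightarrow> complex set"
  where "op_spectrum T = {z. \<not> invertible_on UNIV (\<lambda>x. z *\<^sub>C x - T x)}"

definition unitary_on :: "'a::chilbert_space set \<Rightarrow> ('a \<Rightarrow> 'a) \<Rightarrow> bool"
  where "unitary_on M U \<longleftrightarrow> bounded_op_on M U \<and> U ` M = M \<and>
    (\<forall>x\<in>M. \<forall>y\<in>M. cinner (U x) (U y) = cinner x y)"


section \<open>Moore-Penrose inverses\<close>

definition is_mp_inverse_on :: "'a::chilbert_space set \<Rightarrow> ('a \<Rightarrow> 'a) \<Rightarrow> ('a \<Rightarrow> 'a) \<Rightarrow> bool"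
  where "is_mp_inverse_on M X Y \<longleftrightarrow> bounded_op_on M Y \<and>
    (\<forall>x\<in>M. X (Y (X x)) = X x) \<and>
    (\<forall>x\<in>M. Y (X (Y x)) = Y x) \<and>
    selfadjoint_on M (\<lambda>x. X (Y x)) \<and>
    selfadjoint_on M (\<lambda>x. Y (X x))"

text \<open>
  The Moore-Penrose inverse is unique as an operator on \<open>M\<close>; its values outside \<open>M\<close> are arbitrary,
  whence \<open>SOME\<close> instead of \<open>THE\<close>.
\<close>

definition mp_inverse_on :: "'a::chilbert_space set \<Rightarrow> ('a \<Rightarrow> 'a) \<Rightarrow> 'a \<Rightarrow> 'a"
  where "mp_inverse_on M X = (SOME Y. is_mp_inverse_on M X Y)"

lemma is_mp_inverse_on_unique:
  assumes X: "bounded_op_on M X"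
    and Y: "is_mp_inverse_on M X Y" and Z: "is_mp_inverse_on M X Z"
    and sub: "\<And>x y. x \<in> M \<Longrightarrow> y \<in> M \<Longrightarrow> x - y \<in> M"
    and x: "x \<in> M"
  shows "Y x = Z x"
proof -
  have XM: "X u \<in> M" and YM: "Y u \<in> M" and ZM: "Z u \<in> M" if "u \<in> M" for u
    using X Y Z that by (auto simp: bounded_op_on_def is_mp_inverse_on_def)
  have ext: "a = b" if "a \<in> M" "b \<in> M" "\<And>u. u \<in> M \<Longrightarrow> cinner u a = cinner u b" for a b
  proof -
    have "cinner (a - b) a = cinner (a - b) b"
      using that sub by blast
    then have "(a - b) \<bullet> a = (a - b) \<bullet> b"
      by (metis Re_cinner)
    then show "a = b"
      by (metis inner_diff_right inner_eq_zero_iff right_minus_eq)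
  qed
  have Y1: "X (Y (X u)) = X u" and Y2: "Y (X (Y u)) = Y u"
    and Z1: "X (Z (X u)) = X u" and Z2: "Z (X (Z u)) = Z u" if "u \<in> M" for u
    using Y Z that by (auto simp: is_mp_inverse_on_def)
  have Y3: "cinner (X (Y u)) v = cinner u (X (Y v))" and Y4: "cinner (Y (X u)) v = cinner u (Y (X v))"
    and Z3: "cinner (X (Z u)) v = cinner u (X (Z v))" and Z4: "cinner (Z (X u)) v = cinner u (Z (X v))"
    if "u \<in> M" "v \<in> M" for u v
    using Y Z that by (auto simp: is_mp_inverse_on_def is_adjoint_on_def)
  have XYZ: "X (Y v) = X (Z v)" if v: "v \<in> M" for v
  proof (rule ext)
    fix u assume u: "u \<in> M"
    have "cinner u (X (Y v)) = cinner (X (Y u)) v"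
      using Y3 u v by simp
    also have "\<dots> = cinner (X (Z (X (Y u)))) v"
      using Z1 YM u by simp
    also have "\<dots> = cinner u (X (Y (X (Z v))))"
      using Z3 Y3 XM YM ZM u v by simp
    also have "\<dots> = cinner u (X (Z v))"
      using Y1 ZM v by simp
    finally show "cinner u (X (Y v)) = cinner u (X (Z v))" .
  qed (use XM YM ZM v in auto)
  have YZX: "Y (X v) = Z (X v)" if v: "v \<in> M" for v
  proof (rule ext)
    fix u assume u: "u \<in> M"
    have "cinner u (Y (X v)) = cinner u (Y (X (Z (X v))))"
      using Z1 v by simp
    also have "\<dots> = cinner (Z (X (Y (X u)))) v"
      using Z4 Y4 XM YM ZM u v by simp
    also have "\<dots> = cinner u (Z (X v))"
      using Y1 Z4 u v by simp
    finally show "cinner u (Y (X v)) = cinner u (Z (X v))" .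
  qed (use XM YM ZM v in auto)
  show ?thesis
    using XYZ[OF x] YZX[OF ZM[OF x]] Y2[OF x] Z2[OF x] by metis
qed


section \<open>Singular value decompositions and regularization\<close>

definition orthonormal_basis_on :: "'a::chilbert_space set \<Rightarrow> nat \<Rightarrow> (nat \<Rightarrow> 'a) \<Rightarrow> bool"
  where "orthonormal_basis_on M k e \<longleftrightarrow>
    (\<forall>i<k. \<forall>j<k. cinner (e i) (e j) = (if i = j then 1 else 0)) \<and> cspan (e ` {..<k}) = M"

text \<open>The operator with matrix \<open>diag(d 0, \<dots>, d (k - 1))\<close> in the orthonormal basis \<open>e\<close>.\<close>

definition diag_op :: "nat \<Rightarrow> (nat \<Rightarrow> 'a) \<Rightarrow> (nat \<Rightarrow> real) \<Rightarrow> 'a \<Rightarrow> 'a::chilbert_space"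
  where "diag_op k e d x = (\<Sum>j<k. (complex_of_real (d j) * cinner (e j) x) *\<^sub>C e j)"

definition is_svd_on ::
    "'a::chilbert_space set \<Rightarrow> ('a \<Rightarrow> 'a) \<Rightarrow> nat \<Rightarrow> (nat \<Rightarrow> 'a) \<Rightarrow> ('a \<Rightarrow> 'a) \<Rightarrow> (nat \<Rightarrow> real) \<Rightarrow> ('a \<Rightarrow> 'a) \<Rightarrow> bool"
  where "is_svd_on M S k e U d V \<longleftrightarrow>
    orthonormal_basis_on M k e \<and> unitary_on M U \<and> unitary_on M V \<and>
    (\<forall>j<k. 0 \<le> d j) \<and> mono_on {..<k} d \<and>
    (\<forall>x\<in>M. S x = U (diag_op k e d (V x)))"

definition is_regularization_on ::
    "'a::chilbert_space set \<Rightarrow> real \<Rightarrow> ('a \<Rightarrow> 'a) \<Rightarrow> ('a \<Rightarrow> 'a) \<Rightarrow> bool"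
  where "is_regularization_on M \<epsilon> S R \<longleftrightarrow>
    (\<exists>k e U d V. is_svd_on M S k e U d V \<and>
      (\<forall>x\<in>M. R x = U (diag_op k e (\<lambda>j. if d j \<le> \<epsilon> then 0 else d j) (V x))))"

text \<open>
  On a finite dimensional \<open>M\<close> a singular value decomposition exists, and the regularized operator
  on \<open>M\<close> does not depend on which one (and which orthonormal basis) is used; \<open>SOME\<close> again only
  leaves the values outside \<open>M\<close> open.
\<close>

definition regularization_on :: "'a::chilbert_space set \<Rightarrow> real \<Rightarrow> ('a \<Rightarrow> 'a) \<Rightarrow> 'a \<Rightarrow> 'a"
  where "regularization_on M \<epsilon> S = (SOME R. is_regularization_on M \<epsilon> S R)"


section \<open>Filtrations and quasidiagonal operators\<close>

definition finite_rank_projection :: "('a::chilbert_space \<Rightarrow> 'a) \<Rightarrow> bool"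
  where "finite_rank_projection P \<longleftrightarrow>
    bounded_op_on UNIV P \<and> selfadjoint_on UNIV P \<and> (\<forall>x. P (P x) = P x) \<and>
    (\<exists>B. finite B \<and> range P = cspan B)"

definition filtration :: "(nat \<Rightarrow> 'a::chilbert_space \<Rightarrow> 'a) \<Rightarrow> bool"
  where "filtration P \<longleftrightarrow>
    (\<forall>n. finite_rank_projection (P n)) \<and>
    (\<forall>n. range (P n) \<subseteq> range (P (Suc n))) \<and>
    (\<forall>v. (\<lambda>n. norm (P n v - v)) \<longlonglongrightarrow> 0)"

abbreviation commutator :: "('a::chilbert_space \<Rightarrow> 'a) \<Rightarrow> ('a \<Rightarrow> 'a) \<Rightarrow> 'a \<Rightarrow> 'a"
  where "commutator A B \<equiv> (\<lambda>x. A (B x) - B (A x))"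

definition quasidiagonal :: "('a::chilbert_space \<Rightarrow> 'a) \<Rightarrow> bool"
  where "quasidiagonal T \<longleftrightarrow>
    (\<exists>Q. (\<forall>n::nat. finite_rank_projection (Q n)) \<and>
      (\<forall>v. (\<lambda>n. norm (Q n v - v)) \<longlonglongrightarrow> 0) \<and>
      (\<lambda>n. onorm (commutator T (Q n))) \<longlonglongrightarrow> 0)"

definition compression :: "('a::chilbert_space \<Rightarrow> 'a) \<Rightarrow> ('a \<Rightarrow> 'a) \<Rightarrow> 'a \<Rightarrow> 'a"
  where "compression P T x = P (T (P x))"

end

theory Submission
  imports Defs
begin

text \<open>
  On \<open>P\<^sub>n H\<close> the compression differs from \<open>T\<close> in norm by at most \<open>\<delta>\<^sub>n = \<parallel>[P\<^sub>n, T]\<parallel>\<close>, while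
  \<open>P\<^sub>n T P\<^sub>n\<close> converges strongly to \<open>T\<close>. Hence lower bounds for \<open>T\<close> pass to the compressions up to
  \<open>\<delta>\<^sub>n\<close>, and lower bounds that hold for infinitely many compressions pass to \<open>T\<close>; since a compression
  acts on a finite dimensional space, a lower bound already makes it invertible.

  For the generalized condition numbers let \<open>g = 1 / \<parallel>T\<^sup>+\<parallel>\<close>. Then \<open>\<parallel>T x\<parallel> \<ge> g \<parallel>x\<parallel>\<close> on the orthogonal
  complement of the kernel, and \<open>g\<^sup>2\<close> lies in the spectrum of \<open>T\<^sup>* T\<close>, so that \<open>\<epsilon> < g\<close>. A singular value
  \<open>s\<close> of \<open>P\<^sub>n T P\<^sub>n\<close> makes \<open>s\<^sup>2\<close> an approximate eigenvalue of \<open>T\<^sup>* T\<close> with an error of order \<open>\<delta>\<^sub>n\<close>, so for large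
  \<open>n\<close> the singular values cluster at \<open>0\<close> and in \<open>[g, \<parallel>T\<parallel>]\<close>. Cutting off at \<open>\<epsilon>\<close> therefore removes exactly
  the first cluster, and the smallest remaining singular value tends to \<open>g\<close> because \<open>g\<close> is attained
  approximately by unit vectors orthogonal to the kernel.
\<close>

section \<open>Complex inner products and a variational lemma\<close>

text \<open>Adjoints, orthogonal projections, least squares solutions and Moore-Penrose inverses all
  come from one variational lemma, \<open>lax_milgram\<close>, which sees only the real inner
  product; complex identities are recovered by testing with multiples by \<open>\<i>\<close>.

  Two obstacles shape the rest. In infinite dimension a lower bound does not make an operator onto
  (unilateral shift), so when bounds pass from the compressions to \<open>T\<close>, surjectivity
  needs its own argument, and there the commutators have to be small. Secondly, the discarded
  singular vectors of a compression need not lie in the kernel of \<open>T\<close>, nor is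
  \<open>P n b\<close> orthogonal to them when \<open>b\<close> is orthogonal to that kernel. A
  second threshold \<open>\<eta>\<close>, smaller than \<open>\<epsilon>\<close> would suggest,
  measures how nearly they are annihilated.

  The regularization is a choice among those given by arbitrary decompositions \<open>U D V\<close>.
  Rewriting them by left and right singular vectors makes cut-off and Moore-Penrose inversion mere
  changes of the coefficients \<open>d\<close>.\<close>

lemma cinner_add_left: "cinner (x + y) z = cinner x z + cinner y z"
  by (metis cinner_add_right cinner_commute complex_cnj_add)

lemma cinner_scaleC_left: "cinner (c *\<^sub>C x) y = cnj c * cinner x y"
  by (metis cinner_commute cinner_scaleC_right complex_cnj_mult)

lemma cinner_zero_right [simp]: "cinner x 0 = 0"
  using cinner_add_right[of x 0 0] by simp

lemma cinner_zero_left [simp]: "cinner 0 x = 0"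
  using cinner_add_left[of 0 0 x] by simp

lemma cinner_diff_right: "cinner x (y - z) = cinner x y - cinner x z"
  using cinner_add_right[of x "y - z" z] by (simp add: algebra_simps)

lemma cinner_sum_right: "cinner x (\<Sum>i\<in>A. f i) = (\<Sum>i\<in>A. cinner x (f i))"
  by (induction A rule: infinite_finite_induct) (simp_all add: cinner_add_right)

lemma cinner_sum_left: "cinner (\<Sum>i\<in>A. f i) x = (\<Sum>i\<in>A. cinner (f i) x)"
  by (induction A rule: infinite_finite_induct) (simp_all add: cinner_add_left)

text \<open>Lets the real inner product carry the arguments: a complex identity is the real one at
  \<open>x\<close> together with the real one at \<open>\<i> *\<^sub>C x\<close>.\<close>

lemma Im_cinner: "Im (cinner x y) = (\<i> *\<^sub>C x) \<bullet> y"
  by (simp flip: Re_cinner add: cinner_scaleC_left)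

lemma cinner_self: "cinner x x = complex_of_real ((norm x)\<^sup>2)"
proof (rule complex_eqI)
  show "Re (cinner x x) = Re (complex_of_real ((norm x)\<^sup>2))"
    by (simp add: Re_cinner power2_norm_eq_inner)
  have "Im (cinner x x) = - Im (cinner x x)"
    using arg_cong[OF cinner_commute[of x x], of Im] by simp
  then show "Im (cinner x x) = Im (complex_of_real ((norm x)\<^sup>2))"
    by simp
qed

lemma norm_scaleC: "norm (c *\<^sub>C x) = cmod c * norm (x::'a::chilbert_space)"
proof -
  have "complex_of_real ((norm (c *\<^sub>C x))\<^sup>2) = (c * cnj c) * cinner x x"
    by (simp only: cinner_self[symmetric] cinner_scaleC_left cinner_scaleC_right mult_ac)
  also have "\<dots> = complex_of_real ((cmod c * norm x)\<^sup>2)"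
    by (simp only: cinner_self power_mult_distrib of_real_mult complex_norm_square)
  finally have "(norm (c *\<^sub>C x))\<^sup>2 = (cmod c * norm x)\<^sup>2"
    by (simp only: of_real_eq_iff)
  then show ?thesis
    by (simp add: power2_eq_iff_nonneg)
qed

text \<open>A unimodular factor on \<open>y\<close> makes the inner product real and nonnegative,
  after which the real inequality applies.\<close>

lemma cinner_Cauchy_Schwarz: "cmod (cinner x y) \<le> norm x * norm (y::'a::chilbert_space)"
proof (cases "cinner x y = 0")
  case False
  define c where "c = cnj (cinner x y) / cmod (cinner x y)"
  have c: "cmod c = 1"
    using False by (simp add: c_def norm_divide)
  have "cmod (cinner x y) = Re (cinner x (c *\<^sub>C y))"
  proof -
    have "c * cinner x y = complex_of_real (cmod (cinner x y))"
      using False complex_norm_square[of "cinner x y"]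
      by (simp add: c_def power2_eq_square field_simps)
    then show ?thesis
      by (simp add: cinner_scaleC_right)
  qed
  also have "\<dots> \<le> norm x * norm (c *\<^sub>C y)"
    by (simp only: Re_cinner norm_cauchy_schwarz)
  finally show ?thesis
    using c by (simp add: norm_scaleC)
qed simp

lemma is_adjoint_on_UNIV_of_inner:
  assumes T: "\<And>c x. T (c *\<^sub>C x) = c *\<^sub>C T x"
    and S: "\<And>x y. T x \<bullet> y = x \<bullet> S y"
  shows "is_adjoint_on UNIV T S"
  unfolding is_adjoint_on_def
proof (intro ballI complex_eqI)
  fix x y
  show "Re (cinner (T x) y) = Re (cinner x (S y))"
    by (simp add: Re_cinner S)
  have "\<i> *\<^sub>C T x = T (\<i> *\<^sub>C x)"
    by (simp add: T)
  then show "Im (cinner (T x) y) = Im (cinner x (S y))"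
    by (simp only: Im_cinner S)
qed

text \<open>A map with a formal adjoint is automatically linear, since its values are determined by
  their inner products.\<close>

lemma bounded_linear_of_eq_inner:
  fixes X :: "'a::real_inner \<Rightarrow> 'b::real_inner"
  assumes "\<And>x y. X x \<bullet> y = x \<bullet> Y y" and "\<And>x. norm (X x) \<le> norm x * K"
  shows "bounded_linear X"
proof (rule bounded_linear_intro)
  show "X (x + y) = X x + X y" for x y
  proof -
    have "(X (x + y) - (X x + X y)) \<bullet> z = 0" for z
      by (simp add: inner_diff_left inner_add_left assms(1))
    then show ?thesis
      by (metis inner_eq_zero_iff right_minus_eq)
  qed
  show "X (r *\<^sub>R x) = r *\<^sub>R X x" for r x
  proof -
    have "(X (r *\<^sub>R x) - r *\<^sub>R X x) \<bullet> z = 0" for z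
      by (simp add: inner_diff_left assms(1))
    then show ?thesis
      by (metis inner_eq_zero_iff right_minus_eq)
  qed
qed (rule assms(2))

lemma linear_coeff_zero_if_quadratic_nonneg:
  fixes a b :: real
  assumes "b \<ge> 0" and "\<And>t. 2 * t * a + t\<^sup>2 * b \<ge> 0"
  shows "a = 0"
proof (rule ccontr)
  assume "a \<noteq> 0"
  \<comment> \<open>The vertex of the parabola would be \<open>- a / b\<close>; enlarging the
    denominator covers \<open>b = 0\<close> and still gives a negative value.\<close>
  have "0 \<le> 2 * (- a / (b + 1)) * a + (- a / (b + 1))\<^sup>2 * b"
    by (rule assms(2))
  also have "\<dots> = - a\<^sup>2 * (b + 2) / (b + 1)\<^sup>2"
    using assms(1) by (simp add: field_simps power2_eq_square add_nonneg_eq_0_iff)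
  also have "\<dots> < 0"
    using \<open>a \<noteq> 0\<close> assms(1) by (simp add: divide_neg_pos mult_neg_pos)
  finally show False by simp
qed

text \<open>A minimiser of \<open>\<parallel>T x\<parallel>\<^sup>2 - 2 f x\<close> over \<open>W\<close> satisfies the variational identity; minimising
  sequences are Cauchy by the parallelogram law.\<close>

lemma lax_milgram:
  fixes T :: "'a::{real_inner,complete_space} \<Rightarrow> 'b::real_inner"
  assumes W: "subspace W" "closed W" and T: "bounded_linear T" and f: "bounded_linear f"
    and K: "\<And>x. x \<in> W \<Longrightarrow> norm x \<le> K * norm (T x)"
  shows "\<exists>x\<in>W. \<forall>z\<in>W. T x \<bullet> T z = f z"
proof -
  interpret T: bounded_linear T by fact
  interpret f: bounded_linear f by fact
  define q where "q x = (norm (T x))\<^sup>2 - 2 * f x" for x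
  obtain F where F: "F > 0" "\<And>x. \<bar>f x\<bar> \<le> norm x * F"
    using f.pos_bounded by auto
  \<comment> \<open>\<open>K\<close> may be nonpositive if \<open>W\<close> is trivial; the
    estimates below need a positive factor.\<close>
  define L where "L = max K 1"
  have L: "L > 0" "\<And>x. x \<in> W \<Longrightarrow> norm x \<le> L * norm (T x)"
    by (simp_all add: L_def) (meson K max.cobounded1 mult_right_mono norm_ge_zero order_trans)
  have q_lower: "- (F * L)\<^sup>2 \<le> q x" if "x \<in> W" for x
  proof -
    have "f x \<le> norm x * F"
      using F(2)[of x] by linarith
    also have "\<dots> \<le> L * norm (T x) * F"
      using L(2)[OF that] F(1) by (simp add: mult_right_mono)
    finally have "- (F * L)\<^sup>2 + (norm (T x) - F * L)\<^sup>2 \<le> q x"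
      by (simp add: q_def power2_eq_square algebra_simps)
    moreover have "0 \<le> (norm (T x) - F * L)\<^sup>2" by simp
    ultimately show ?thesis by linarith
  qed
  define m where "m = Inf (q ` W)"
  have bdd: "bdd_below (q ` W)"
    using q_lower by (intro bdd_belowI[of _ "- (F * L)\<^sup>2"]) auto
  have m: "m \<le> q x" if "x \<in> W" for x
    unfolding m_def using bdd that by (intro cInf_lower) auto
  have "\<exists>x\<in>W. q x < m + 1 / Suc n" for n
  proof -
    have "q ` W \<noteq> {}"
      using subspace_0[OF W(1)] by auto
    then have "(Inf (q ` W) < m + 1 / Suc n) \<longleftrightarrow> (\<exists>y\<in>q ` W. y < m + 1 / Suc n)"
      using bdd by (rule cInf_less_iff)
    then show ?thesis
      by (auto simp: m_def)
  qed
  then obtain X where X: "\<And>n. X n \<in> W" "\<And>n. q (X n) < m + 1 / Suc n"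
    by metis
  \<comment> \<open>The linear terms of \<open>q\<close> cancel between the two points and their
    midpoint, which leaves the parallelogram law for \<open>T\<close>.\<close>
  have par: "(norm (T (x - y)))\<^sup>2 = 2 * q x + 2 * q y - 4 * q ((1/2) *\<^sub>R (x + y))" for x y
    unfolding q_def T.diff T.add T.scaleR f.add f.scaleR power2_norm_eq_inner
    by (simp add: inner_add_left inner_add_right inner_diff_left inner_diff_right inner_commute
        algebra_simps)
  have dist: "(norm (X i - X j))\<^sup>2 \<le> L\<^sup>2 * (2 / Suc i + 2 / Suc j)" for i j
  proof -
    have "(1/2) *\<^sub>R (X i + X j) \<in> W"
      using X(1) W(1) by (intro subspace_scale subspace_add)
    then have "(norm (T (X i - X j)))\<^sup>2 \<le> 2 / Suc i + 2 / Suc j"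
      using par[of "X i" "X j"] m X(2)[of i] X(2)[of j] by fastforce
    moreover have "norm (X i - X j) \<le> L * norm (T (X i - X j))"
      using X(1) W(1) by (intro L subspace_diff)
    then have "(norm (X i - X j))\<^sup>2 \<le> L\<^sup>2 * (norm (T (X i - X j)))\<^sup>2"
      by (metis norm_ge_zero power_mono power_mult_distrib)
    ultimately show ?thesis
      by (smt (verit) mult_left_mono zero_le_power2)
  qed
  have "Cauchy X"
  proof (rule CauchyI)
    fix e :: real assume e: "0 < e"
    obtain N :: nat where N: "4 * L\<^sup>2 / e\<^sup>2 < N"
      using reals_Archimedean2 by blast
    have "norm (X i - X j) < e" if "i \<ge> N" "j \<ge> N" for i j
    proof -
      have N0: "N > 0"
        using N by (metis divide_nonneg_nonneg gr0I less_le_not_le mult_nonneg_nonneg of_nat_0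
            zero_le_numeral zero_le_power2)
      have "2 / real (Suc i) + 2 / real (Suc j) \<le> 2 / N + 2 / N"
        using that N0 by (intro add_mono divide_left_mono) auto
      then have "L\<^sup>2 * (2 / Suc i + 2 / Suc j) \<le> L\<^sup>2 * (4 / N)"
        by (intro mult_left_mono) auto
      also have "\<dots> < e\<^sup>2"
        using N N0 e by (simp add: field_simps)
      finally have "(norm (X i - X j))\<^sup>2 < e\<^sup>2"
        using dist[of i j] by linarith
      then show ?thesis
        using e by (simp add: power2_less_imp_less)
    qed
    then show "\<exists>M. \<forall>m\<ge>M. \<forall>n\<ge>M. norm (X m - X n) < e"
      by blast
  qed
  then obtain x where x: "X \<longlonglongrightarrow> x"
    using Cauchy_convergent convergent_def by blast
  have xW: "x \<in> W"
    using W(2) X(1) x closed_sequentially by blast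
  have "(\<lambda>n. q (X n)) \<longlonglongrightarrow> q x"
    unfolding q_def by (intro tendsto_intros T.tendsto f.tendsto x)
  moreover have "(\<lambda>n. m + 1 / real (Suc n)) \<longlonglongrightarrow> m + 0"
    by (intro tendsto_add tendsto_const LIMSEQ_Suc lim_1_over_n)
  ultimately have "q x \<le> m + 0"
    by (rule LIMSEQ_le) (use X(2) less_imp_le in blast)
  then have qx: "q x \<le> m"
    by simp
  have "T x \<bullet> T z = f z" if z: "z \<in> W" for z
  proof -
    have "2 * t * (T x \<bullet> T z - f z) + t\<^sup>2 * (norm (T z))\<^sup>2 \<ge> 0" for t
    proof -
      have "q x \<le> q (x + t *\<^sub>R z)"
        using qx m W(1) xW z by (meson order_trans subspace_add subspace_scale)
      also have "q (x + t *\<^sub>R z) = q x + (2 * t * (T x \<bullet> T z - f z) + t\<^sup>2 * (norm (T z))\<^sup>2)"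
        unfolding q_def T.add T.scaleR f.add f.scaleR power2_norm_eq_inner
        by (simp add: inner_add_left inner_add_right inner_commute algebra_simps power2_eq_square)
      finally show ?thesis by simp
    qed
    then show ?thesis
      using linear_coeff_zero_if_quadratic_nonneg[of "(norm (T z))\<^sup>2" "T x \<bullet> T z - f z"] by simp
  qed
  then show ?thesis
    using xW by blast
qed

text \<open>With the identity as operator and the whole space as \<open>W\<close>,
  \<open>lax_milgram\<close> is the Riesz representation theorem, here applied to
  \<open>\<lambda>x. T x \<bullet> y\<close>.\<close>

lemma real_adjoint_ex:
  fixes T :: "'a::{real_inner,complete_space} \<Rightarrow> 'b::real_inner"
  assumes T: "bounded_linear T"
  shows "\<exists>S. bounded_linear S \<and> (\<forall>x y. T x \<bullet> y = x \<bullet> S y)"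
proof -
  have "\<exists>s. \<forall>x. T x \<bullet> y = x \<bullet> s" for y
  proof -
    have "bounded_linear (\<lambda>x. T x \<bullet> y)"
      using T by (rule bounded_linear_compose[OF bounded_linear_inner_left])
    then have "\<exists>s\<in>UNIV. \<forall>x\<in>UNIV. id s \<bullet> id x = T x \<bullet> y"
      by (intro lax_milgram[where K = 1]) (auto simp: id_def)
    then show ?thesis
      by (metis UNIV_I id_apply inner_commute)
  qed
  then obtain S where S: "\<And>x y. T x \<bullet> y = x \<bullet> S y"
    by metis
  obtain K where K: "K \<ge> 0" "\<And>x. norm (T x) \<le> norm x * K"
    using bounded_linear.nonneg_bounded[OF T] by blast
  have "norm (S y) \<le> norm y * K" for y
  proof -
    have "norm (S y) * norm (S y) = T (S y) \<bullet> y"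
      by (simp add: S dot_square_norm power2_eq_square)
    also have "\<dots> \<le> norm (T (S y)) * norm y"
      by (rule norm_cauchy_schwarz)
    also have "\<dots> \<le> norm (S y) * (norm y * K)"
      using mult_right_mono[OF K(2)[of "S y"], of "norm y"] by (simp add: algebra_simps)
    finally have "norm (S y) * norm (S y) \<le> norm (S y) * (norm y * K)" .
    then show ?thesis
      using K(1) by (cases "norm (S y) = 0") (simp_all add: mult_le_cancel_left)
  qed
  then have "bounded_linear S"
    using S by (intro bounded_linear_of_eq_inner[of S T K]) (simp_all add: inner_commute)
  with S show ?thesis by blast
qed

section \<open>Operators with closed range\<close>

instance chilbert_space \<subseteq> banach ..

lemma inner_scaleC_left: "(c *\<^sub>C x) \<bullet> y = x \<bullet> (cnj c *\<^sub>C y)"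
  by (simp flip: Re_cinner add: cinner_scaleC_left cinner_scaleC_right)

text \<open>Otherwise a gliding hump: some \<open>y\<close> in the closed range would have \<open>\<bar>y \<bullet> w n\<bar>\<close> at least
  \<open>\<parallel>w n\<parallel> / (2 \<cdot> 3\<^sup>n)\<close>, whereas \<open>y = T x\<close> forces \<open>\<bar>y \<bullet> w n\<bar> \<le> \<parallel>x\<parallel> \<parallel>w n\<parallel> / 4\<^sup>n\<close>.\<close>

lemma adjoint_bounded_below_on_closed_range:
  fixes T :: "'a::real_inner \<Rightarrow> 'b::{real_inner,banach}"
  assumes T: "bounded_linear T" and adj: "\<And>x y. T x \<bullet> y = x \<bullet> S y" and cl: "closed (range T)"
  shows "\<exists>C. \<forall>w\<in>range T. norm w \<le> C * norm (S w)"
proof (rule ccontr)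
  assume "\<not> ?thesis"
  then have "\<forall>n. \<exists>w\<in>range T. norm w > 4 ^ n * norm (S w)"
    by (meson not_le)
  then obtain w where w: "\<And>n. w n \<in> range T" "\<And>n. norm (w n) > 4 ^ n * norm (S (w n))"
    by metis
  have W: "subspace (range T)"
    using T by (simp add: bounded_linear.linear linear_subspace_image)
  have w0: "norm (w n) > 0" for n
    using w(2)[of n] by (smt (verit) mult_nonneg_nonneg norm_ge_zero zero_le_power)
  \<comment> \<open>The ratio 1/3 is small enough that everything after the n-th hump adds up to
    only half of it, yet large compared with the 1/4 that governs \<open>w\<close>.\<close>
  define h where "h n = ((1/3) ^ n / norm (w n)) *\<^sub>R w n" for n
  have norm_h: "norm (h n) = (1/3) ^ n" for n
    using w0[of n] by (simp add: h_def)
  have inner_h: "h n \<bullet> w n = (1/3) ^ n * norm (w n)" for n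
    using w0[of n] by (simp add: h_def dot_square_norm power2_eq_square)
  \<comment> \<open>The sign of each hump follows that of the inner product accumulated so far, so
    the new term never cancels the old ones.\<close>
  define y where "y = rec_nat 0 (\<lambda>n a. a + (if 0 \<le> a \<bullet> w n then h n else - h n))"
  have y_Suc: "y (Suc n) = y n + (if 0 \<le> y n \<bullet> w n then h n else - h n)" and y0: "y 0 = 0" for n
    by (simp_all add: y_def)
  define t where "t n = y (Suc n) - y n" for n
  have norm_t: "norm (t n) = (1/3) ^ n" for n
    by (simp add: t_def y_Suc norm_h)
  have y_range: "y n \<in> range T" for n
  proof (induction n)
    case 0
    show ?case
      using subspace_0[OF W] by (simp add: y0)
  next
    case (Suc n)
    have "h n \<in> range T"
      using w(1)[of n] W by (simp only: h_def subspace_scale)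
    then show ?case
      using Suc W by (auto simp: y_Suc simp del: add_uminus_conv_diff intro!: subspace_add subspace_neg)
  qed
  have y_sum: "y n = (\<Sum>k<n. t k)" for n
    by (simp add: t_def sum_lessThan_telescope y0)
  have summable: "summable t"
    by (rule summable_norm_cancel) (simp add: norm_t summable_geometric)
  define z where "z = suminf t"
  have "y \<longlonglongrightarrow> z"
    using summable_LIMSEQ[OF summable] by (simp add: z_def flip: y_sum)
  then have "z \<in> range T"
    using cl y_range closed_sequentially by blast
  then obtain x where x: "z = T x" by blast
  have tail: "norm (z - y (Suc n)) \<le> (1/3) ^ n / 2" for n
  proof -
    have "z - y (Suc n) = (\<Sum>k. t (k + Suc n))"
      unfolding z_def y_sum suminf_split_initial_segment[OF summable, of "Suc n"] by simp
    also have "norm \<dots> \<le> (\<Sum>k. (1/3) ^ Suc n * (1/3) ^ k)"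
    proof (rule norm_suminf_le)
      show "norm (t (k + Suc n)) \<le> (1/3) ^ Suc n * (1/3) ^ k" for k
        by (simp add: norm_t power_add)
      show "summable (\<lambda>k. (1/3) ^ Suc n * (1/3::real) ^ k)"
        by (intro summable_mult summable_geometric) simp
    qed
    also have "\<dots> = (1/3) ^ n / 2"
      by (subst suminf_mult) (simp_all add: suminf_geometric summable_geometric)
    finally show ?thesis .
  qed
  have bound: "(4/3) ^ n \<le> 2 * norm x" for n
  proof -
    define A where "A = (1/3) ^ n * norm (w n)"
    have "A \<le> \<bar>y (Suc n) \<bullet> w n\<bar>"
      using w0[of n] by (auto simp: A_def y_Suc inner_add_left inner_diff_left inner_h)
    moreover have "\<bar>(z - y (Suc n)) \<bullet> w n\<bar> \<le> (1/3) ^ n / 2 * norm (w n)"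
      by (rule order_trans[OF Cauchy_Schwarz_ineq2 mult_right_mono[OF tail norm_ge_zero]])
    then have "\<bar>z \<bullet> w n - y (Suc n) \<bullet> w n\<bar> \<le> A / 2"
      by (simp only: A_def inner_diff_left times_divide_eq_left)
    ultimately have "A / 2 \<le> \<bar>z \<bullet> w n\<bar>"
      by linarith
    then have "(1/3) ^ n / 2 * norm (w n) \<le> \<bar>z \<bullet> w n\<bar>"
      by (simp only: A_def times_divide_eq_left)
    also have "\<bar>z \<bullet> w n\<bar> \<le> norm x * norm (S (w n))"
      unfolding x adj by (rule Cauchy_Schwarz_ineq2)
    finally have "4 ^ n * ((1/3) ^ n / 2 * norm (w n)) \<le> 4 ^ n * (norm x * norm (S (w n)))"
      by (rule mult_left_mono) simp
    also have "\<dots> = norm x * (4 ^ n * norm (S (w n)))"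
      by (rule mult.left_commute)
    also have "\<dots> \<le> norm x * norm (w n)"
      using w(2)[of n] by (intro mult_left_mono) auto
    finally have "4 ^ n * ((1/3) ^ n / 2) * norm (w n) \<le> norm x * norm (w n)"
      by (simp add: mult.assoc)
    then have "4 ^ n * ((1/3) ^ n / 2) \<le> norm x"
      by (rule mult_right_le_imp_le[OF _ w0])
    moreover have "4 ^ n * (1/3) ^ n = (4/3::real) ^ n"
      by (subst power_mult_distrib[symmetric]) simp
    ultimately show ?thesis
      by simp
  qed
  obtain n where "2 * norm x < (4/3) ^ n"
    using real_arch_pow[of "4/3"] by auto
  with bound[of n] show False by simp
qed

text \<open>Passes the lower bound back from the adjoint \<open>S\<close> to \<open>T\<close>: a
  vector \<open>v\<close> orthogonal to the kernel is \<open>S w\<close> with \<open>w\<close> in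
  the range and \<open>norm w \<le> C * norm v\<close>, and pairing \<open>T v\<close> with
  \<open>w\<close> gives \<open>norm v\<close> squared.\<close>

lemma bounded_below_on_kernel_complement:
  fixes T :: "'a::{real_inner,complete_space} \<Rightarrow> 'b::{real_inner,banach}"
  assumes T: "bounded_linear T" and cl: "closed (range T)"
  shows "\<exists>C>0. \<forall>v. (\<forall>x. T x = 0 \<longrightarrow> v \<bullet> x = 0) \<longrightarrow> norm v \<le> C * norm (T v)"
proof -
  interpret T: bounded_linear T by fact
  obtain S where S: "bounded_linear S" and adj: "\<And>x y. T x \<bullet> y = x \<bullet> S y"
    using real_adjoint_ex[OF T] by blast
  interpret S: bounded_linear S by fact
  obtain C0 where C0: "\<And>w. w \<in> range T \<Longrightarrow> norm w \<le> C0 * norm (S w)"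
    using adjoint_bounded_below_on_closed_range[OF T adj cl] by blast
  define C where "C = max C0 1"
  have C: "C > 0" "\<And>w. w \<in> range T \<Longrightarrow> norm w \<le> C * norm (S w)"
    by (simp_all add: C_def) (meson C0 max.cobounded1 mult_right_mono norm_ge_zero order_trans)
  have "norm v \<le> C * norm (T v)" if v: "\<forall>x. T x = 0 \<longrightarrow> v \<bullet> x = 0" for v
  proof -
    have "subspace (range T)"
      using T.linear by (simp add: linear_subspace_image)
    moreover have "bounded_linear (\<lambda>z. v \<bullet> S z)"
      using S by (rule bounded_linear_compose[OF bounded_linear_inner_right])
    ultimately obtain w where w: "w \<in> range T" and Sw: "\<And>z. z \<in> range T \<Longrightarrow> S w \<bullet> S z = v \<bullet> S z"
      using lax_milgram[OF _ cl S _ C(2)] by blast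
    \<comment> \<open>The variational identity is tested at the image of the defect itself.\<close>
    have "T (S w - v) \<bullet> T (S w - v) = 0"
      using Sw[of "T (S w - v)"] by (simp add: adj inner_diff_left)
    then have ker: "T (S w - v) = 0"
      by simp
    then have "v \<bullet> (S w - v) = 0"
      using v by blast
    moreover have "S w \<bullet> (S w - v) = 0"
      using adj[of "S w - v" w] ker by (simp add: inner_commute)
    ultimately have "S w = v"
      by (metis inner_diff_left inner_eq_zero_iff diff_self right_minus_eq)
    then have "norm v * norm v = T v \<bullet> w"
      by (simp add: adj dot_square_norm power2_eq_square)
    also have "\<dots> \<le> norm (T v) * (C * norm v)"
      using norm_cauchy_schwarz[of "T v" w] C(2)[OF w] \<open>S w = v\<close>
      by (metis mult_left_mono norm_ge_zero order_trans)
    finally have "norm v * norm v \<le> norm v * (C * norm (T v))"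
      by (simp add: mult_ac)
    then show ?thesis
      using C(1) by (cases "norm v = 0") (simp_all add: mult_le_cancel_left)
  qed
  with C(1) show ?thesis by blast
qed

text \<open>\<open>Y y\<close> is the least squares solution of \<open>T x = y\<close> within the
  orthogonal complement \<open>E\<close> of the kernel, so that \<open>T (Y y)\<close> is the
  orthogonal projection of \<open>y\<close> onto the range.\<close>

lemma mp_inverse_ex:
  assumes T: "bounded_op_on UNIV T" and cl: "closed (range T)"
  shows "\<exists>Y. is_mp_inverse_on UNIV T Y"
proof -
  have T': "bounded_linear T" and TC: "\<And>c x. T (c *\<^sub>C x) = c *\<^sub>C T x"
    using T by (simp_all add: bounded_op_on_UNIV)
  interpret T: bounded_linear T by fact
  define N where "N = {x. T x = 0}"
  define E where "E = {v. \<forall>x. T x = 0 \<longrightarrow> v \<bullet> x = 0}"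
  have N: "subspace N" "closed N"
  proof -
    show "subspace N"
      unfolding N_def by (simp add: T.linear linear_subspace_kernel)
    have "N = T -` {0}"
      by (auto simp: N_def)
    then show "closed N"
      using T.continuous_on[OF continuous_on_id] by (simp add: continuous_on_closed_vimage closed_vimage)
  qed
  have E: "subspace E" "closed E"
  proof -
    show "subspace E"
      by (auto simp: subspace_def E_def inner_add_left)
    have "E = (\<Inter>x\<in>N. {v. x \<bullet> v = 0})"
      by (auto simp: E_def N_def inner_commute)
    then show "closed E"
      by (simp add: closed_INT closed_hyperplane)
  qed
  obtain C where C: "C > 0" "\<And>v. v \<in> E \<Longrightarrow> norm v \<le> C * norm (T v)"
    using bounded_below_on_kernel_complement[OF T' cl] by (auto simp: E_def)
  have EN: "v = 0" if "v \<in> E" "T v = 0" for v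
    using that by (auto simp: E_def)
  \<comment> \<open>For the identity on the kernel, \<open>lax_milgram\<close> yields the orthogonal
    projection \<open>p\<close> of \<open>z\<close>; subtracting it does not change the
    image.\<close>
  have decomp: "\<exists>u\<in>E. T u = T z" for z
  proof -
    have "\<exists>p\<in>N. \<forall>u\<in>N. id p \<bullet> id u = z \<bullet> u"
      using N by (intro lax_milgram[where K = 1]) (auto simp: id_def bounded_linear_inner_right)
    then obtain p where "p \<in> N" "\<And>u. u \<in> N \<Longrightarrow> p \<bullet> u = z \<bullet> u"
      by auto
    then have "z - p \<in> E" "T (z - p) = T z"
      by (auto simp: N_def E_def inner_diff_left T.diff)
    then show ?thesis by blast
  qed
  have "\<exists>x\<in>E. \<forall>z. T x \<bullet> T z = y \<bullet> T z" for y
  proof -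
    have "bounded_linear (\<lambda>z. y \<bullet> T z)"
      using T' by (rule bounded_linear_compose[OF bounded_linear_inner_right])
    then obtain x where "x \<in> E" "\<And>z. z \<in> E \<Longrightarrow> T x \<bullet> T z = y \<bullet> T z"
      using lax_milgram[OF E T' _ C(2)] by blast
    then show ?thesis
      by (metis decomp)
  qed
  then obtain Y where YE: "\<And>y. Y y \<in> E" and Y: "\<And>y z. T (Y y) \<bullet> T z = y \<bullet> T z"
    by metis
  \<comment> \<open>Since elements of \<open>E\<close> are determined by how their images pair with
    the range, additivity and homogeneity of \<open>Y\<close> reduce to identities of inner
    products.\<close>
  have uniq: "a = b" if "a \<in> E" "b \<in> E" "\<And>z. T a \<bullet> T z = T b \<bullet> T z" for a b
  proof -
    have "T (a - b) \<bullet> T (a - b) = 0"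
      using that(3)[of "a - b"] by (simp add: T.diff inner_diff_left)
    then have "a - b = 0"
      by (intro EN[OF subspace_diff[OF E(1)]] that) simp
    then show ?thesis by simp
  qed
  have TYT: "T (Y (T u)) = T u" for u
  proof -
    have "(T (Y (T u)) - T u) \<bullet> T (Y (T u) - u) = 0"
      by (simp only: inner_diff_left Y diff_self)
    then show ?thesis
      by (simp add: T.diff)
  qed
  have YTe: "Y (T u) = u" if "u \<in> E" for u
    using that by (intro uniq YE) (simp_all add: TYT)
  have YT_ker: "T (u - Y (T u)) = 0" for u
    by (simp add: T.diff TYT)
  have sa1: "T (Y x) \<bullet> y = x \<bullet> T (Y y)" for x y
    using Y[of x "Y y"] Y[of y "Y x"] by (simp add: inner_commute)
  have sa2: "Y (T x) \<bullet> y = x \<bullet> Y (T y)" for x y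
  proof -
    have "Y (T x) \<bullet> (y - Y (T y)) = 0" "Y (T y) \<bullet> (x - Y (T x)) = 0"
      using YE YT_ker by (auto simp: E_def)
    then have "Y (T x) \<bullet> y = Y (T x) \<bullet> Y (T y)" "Y (T y) \<bullet> x = Y (T y) \<bullet> Y (T x)"
      by (simp_all add: inner_diff_right)
    then show ?thesis
      by (metis inner_commute)
  qed
  have YC: "Y (c *\<^sub>C x) = c *\<^sub>C Y x" for c x
  proof (rule uniq)
    show "c *\<^sub>C Y x \<in> E"
      using YE[of x] by (simp add: E_def inner_scaleC_left TC)
    show "T (Y (c *\<^sub>C x)) \<bullet> T z = T (c *\<^sub>C Y x) \<bullet> T z" for z
    proof -
      have "T (Y (c *\<^sub>C x)) \<bullet> T z = x \<bullet> T (cnj c *\<^sub>C z)"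
        by (simp only: Y inner_scaleC_left TC)
      also have "\<dots> = T (Y x) \<bullet> T (cnj c *\<^sub>C z)"
        by (simp only: Y)
      also have "\<dots> = T (c *\<^sub>C Y x) \<bullet> T z"
        by (simp only: inner_scaleC_left TC)
      finally show ?thesis .
    qed
  qed (rule YE)
  have Yb: "norm (Y y) \<le> norm y * C" for y
  proof -
    have "norm (T (Y y)) * norm (T (Y y)) = y \<bullet> T (Y y)"
      using Y[of y "Y y"] by (simp add: dot_square_norm power2_eq_square)
    also have "\<dots> \<le> norm y * norm (T (Y y))"
      by (rule norm_cauchy_schwarz)
    finally have "norm (T (Y y)) \<le> norm y"
      by (cases "norm (T (Y y)) = 0") (simp_all add: mult_le_cancel_right)
    then show ?thesis
      using C(2)[OF YE[of y]] C(1) by (metis mult.commute mult_left_mono order_less_imp_le order_trans)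
  qed
  have Yadd: "Y (x + y) = Y x + Y y" for x y
    by (intro uniq YE subspace_add[OF E(1)]) (simp add: T.add inner_add_left Y)
  have "bounded_op_on UNIV Y"
    unfolding bounded_op_on_def using YC Yb Yadd by blast
  moreover have "selfadjoint_on UNIV (\<lambda>x. T (Y x))" "selfadjoint_on UNIV (\<lambda>x. Y (T x))"
    using sa1 sa2 by (auto intro!: is_adjoint_on_UNIV_of_inner simp: YC TC)
  ultimately have "is_mp_inverse_on UNIV T Y"
    unfolding is_mp_inverse_on_def using TYT YTe[OF YE] by blast
  then show ?thesis by blast
qed

section \<open>Orthonormal bases of finite dimensional subspaces\<close>

lemma onb_cinner:
  "orthonormal_basis_on M k e \<Longrightarrow> i < k \<Longrightarrow> j < k \<Longrightarrow> cinner (e i) (e j) = (if i = j then 1 else 0)"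
  by (simp add: orthonormal_basis_on_def)

lemma onb_span: "orthonormal_basis_on M k e \<Longrightarrow> cspan (e ` {..<k}) = M"
  by (simp add: orthonormal_basis_on_def)

lemma onb_subspace: "orthonormal_basis_on M k e \<Longrightarrow> complex_vector.subspace M"
  using complex_vector.subspace_span[of "e ` {..<k}"] by (simp add: onb_span)

lemma onb_mem: "orthonormal_basis_on M k e \<Longrightarrow> j < k \<Longrightarrow> e j \<in> M"
  using complex_vector.span_base[of "e j" "e ` {..<k}"] by (simp add: onb_span)

lemma onb_norm:
  assumes "orthonormal_basis_on M k e" "j < k"
  shows "norm (e j) = 1"
proof -
  have "complex_of_real ((norm (e j))\<^sup>2) = 1"
    using assms by (simp only: cinner_self[symmetric] onb_cinner) simp
  then have "(norm (e j))\<^sup>2 = 1"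
    by (simp only: of_real_eq_1_iff)
  then show ?thesis
    using power2_eq_iff_nonneg[of "norm (e j)" 1] by simp
qed

lemma onb_sum_mem: "orthonormal_basis_on M k e \<Longrightarrow> (\<Sum>j<k. c j *\<^sub>C e j) \<in> M"
  by (intro complex_vector.subspace_sum onb_subspace complex_vector.subspace_scale onb_mem) auto

lemma onb_coeff:
  assumes "orthonormal_basis_on M k e" "i < k"
  shows "cinner (e i) (\<Sum>j<k. c j *\<^sub>C e j) = c i"
proof -
  have "cinner (e i) (\<Sum>j<k. c j *\<^sub>C e j) = (\<Sum>j<k. if i = j then c j else 0)"
    unfolding cinner_sum_right cinner_scaleC_right
    by (intro sum.cong) (use assms in \<open>auto simp: onb_cinner\<close>)
  also have "\<dots> = c i"
    using assms(2) by simp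
  finally show ?thesis .
qed

lemma onb_expand:
  assumes e: "orthonormal_basis_on M k e" and x: "x \<in> M"
  shows "(\<Sum>j<k. cinner (e j) x *\<^sub>C e j) = x"
proof -
  have "x \<in> complex_vector.span (e ` {..<k})"
    using e x by (simp add: orthonormal_basis_on_def)
  then show ?thesis
  proof (rule complex_vector.span_induct)
    show "complex_vector.subspace {x. (\<Sum>j<k. cinner (e j) x *\<^sub>C e j) = x}"
      by (simp add: complex_vector.subspace_def cinner_add_right scaleC_add_left sum.distrib
          cinner_scaleC_right flip: scaleC_scaleC complex_vector.scale_sum_right)
    fix y assume "y \<in> e ` {..<k}"
    then obtain i where i: "i < k" "y = e i"
      by auto
    have "(\<Sum>j<k. cinner (e j) y *\<^sub>C e j) = (\<Sum>j<k. if i = j then e j else 0)"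
      unfolding i(2) by (intro sum.cong) (use e i(1) in \<open>auto simp: onb_cinner\<close>)
    also have "\<dots> = y"
      using i by simp
    finally show "(\<Sum>j<k. cinner (e j) y *\<^sub>C e j) = y" .
  qed
qed

lemma onb_cinner_sum:
  assumes "orthonormal_basis_on M k e"
  shows "cinner (\<Sum>i<k. a i *\<^sub>C e i) (\<Sum>j<k. b j *\<^sub>C e j) = (\<Sum>i<k. cnj (a i) * b i)"
  unfolding cinner_sum_left cinner_scaleC_left
  by (intro sum.cong) (simp_all add: onb_coeff[OF assms])

lemma onb_norm_sum:
  assumes "orthonormal_basis_on M k e"
  shows "(norm (\<Sum>i<k. a i *\<^sub>C e i))\<^sup>2 = (\<Sum>i<k. (cmod (a i))\<^sup>2)"
proof -
  have "complex_of_real ((norm (\<Sum>i<k. a i *\<^sub>C e i))\<^sup>2) = (\<Sum>i<k. cnj (a i) * a i)"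
    by (simp only: cinner_self[symmetric] onb_cinner_sum[OF assms])
  also have "\<dots> = complex_of_real (\<Sum>i<k. (cmod (a i))\<^sup>2)"
    by (simp only: of_real_sum complex_norm_square mult.commute)
  finally show ?thesis
    by (simp only: of_real_eq_iff)
qed

lemma onb_parseval:
  assumes "orthonormal_basis_on M k e" "x \<in> M"
  shows "(norm x)\<^sup>2 = (\<Sum>i<k. (cmod (cinner (e i) x))\<^sup>2)"
  using onb_norm_sum[OF assms(1), of "\<lambda>i. cinner (e i) x"] onb_expand[OF assms] by simp

text \<open>Double counting: the squared moduli of all mutual inner products, summed by Parseval in
  either basis, give both cardinalities.\<close>

lemma onb_card_unique:
  assumes e: "orthonormal_basis_on M k e" and f: "orthonormal_basis_on M m f"
  shows "k = m"
proof -
  have "real k = (\<Sum>i<k. (norm (e i))\<^sup>2)"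
    using onb_norm[OF e] by simp
  also have "\<dots> = (\<Sum>i<k. \<Sum>j<m. (cmod (cinner (f j) (e i)))\<^sup>2)"
    using onb_mem[OF e] by (intro sum.cong refl onb_parseval[OF f]) auto
  also have "\<dots> = (\<Sum>j<m. \<Sum>i<k. (cmod (cinner (f j) (e i)))\<^sup>2)"
    by (rule sum.swap)
  also have "\<dots> = (\<Sum>j<m. \<Sum>i<k. (cmod (cinner (e i) (f j)))\<^sup>2)"
    by (intro sum.cong refl) (metis cinner_commute complex_mod_cnj)
  also have "\<dots> = (\<Sum>j<m. (norm (f j))\<^sup>2)"
    using onb_mem[OF f] by (intro sum.cong refl onb_parseval[OF e, symmetric]) auto
  also have "\<dots> = real m"
    using onb_norm[OF f] by simp
  finally show ?thesis by simp
qed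

lemma onb_extend:
  assumes e: "orthonormal_basis_on M k e" and u: "norm u = 1" "\<And>x. x \<in> M \<Longrightarrow> cinner u x = 0"
  shows "orthonormal_basis_on (cspan (insert u M)) (Suc k) (e(k := u))"
proof -
  have "cinner (e j) u = 0" if "j < k" for j
    using u(2)[OF onb_mem[OF e that]] by (metis cinner_commute complex_cnj_zero)
  then have 1: "cinner ((e(k := u)) i) ((e(k := u)) j) = (if i = j then 1 else 0)"
    if "i < Suc k" "j < Suc k" for i j
    using that u onb_mem[OF e] by (auto simp: onb_cinner[OF e] cinner_self onb_norm[OF e] less_Suc_eq)
  have "(e(k := u)) ` {..<k} = e ` {..<k}"
    by (intro image_cong) auto
  then have "(e(k := u)) ` {..<Suc k} = insert u (e ` {..<k})"
    by (simp only: lessThan_Suc image_insert fun_upd_same)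
  moreover have "cspan (insert u (e ` {..<k})) = cspan (insert u M)"
  proof -
    have "M = cspan (e ` {..<k})"
      using e by (simp add: orthonormal_basis_on_def)
    moreover have "insert u (e ` {..<k}) \<subseteq> cspan (insert u (cspan (e ` {..<k})))"
      using complex_vector.span_superset by (metis dual_order.trans insert_mono)
    moreover have "insert u (cspan (e ` {..<k})) \<subseteq> cspan (insert u (e ` {..<k}))"
      using complex_vector.span_mono[OF subset_insertI] complex_vector.span_base by blast
    ultimately show ?thesis
      using complex_vector.span_eq by blast
  qed
  ultimately show ?thesis
    using 1 unfolding orthonormal_basis_on_def by simp
qed

text \<open>Gram-Schmidt; a vector equal to its projection \<open>p\<close> adds nothing, so
  \<open>k\<close> may be smaller than the number of generators.\<close>

lemma onb_exists:
  assumes "finite B"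
  shows "\<exists>k e. orthonormal_basis_on (cspan B) k e"
  using assms
proof (induction B)
  case empty
  show ?case
    by (rule exI[of _ 0]) (simp add: orthonormal_basis_on_def)
next
  case (insert b B)
  then obtain k e where e: "orthonormal_basis_on (cspan B) k e"
    by blast
  define p where "p = (\<Sum>j<k. cinner (e j) b *\<^sub>C e j)"
  have p: "p \<in> cspan B"
    unfolding p_def by (rule onb_sum_mem[OF e])
  have orth: "cinner x (b - p) = 0" if "x \<in> cspan B" for x
  proof -
    have "cinner (e j) (b - p) = 0" if "j < k" for j
      unfolding p_def cinner_diff_right onb_coeff[OF e that] by simp
    then have "cinner (\<Sum>j<k. cinner (e j) x *\<^sub>C e j) (b - p) = 0"
      by (simp add: cinner_sum_left cinner_scaleC_left)
    then show ?thesis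
      by (simp only: onb_expand[OF e that])
  qed
  show ?case
  proof (cases "b = p")
    case True
    then have "cspan (insert b B) = cspan B"
      using p complex_vector.span_redundant by blast
    then show ?thesis
      using e by auto
  next
    case False
    define u where "u = complex_of_real (1 / norm (b - p)) *\<^sub>C (b - p)"
    have "norm u = 1"
      using False by (simp add: u_def norm_scaleC norm_divide)
    moreover have "cinner u x = 0" if "x \<in> cspan B" for x
      using orth[OF that] by (simp add: u_def cinner_scaleC_left) (metis cinner_commute complex_cnj_zero)
    ultimately have "orthonormal_basis_on (cspan (insert u (cspan B))) (Suc k) (e(k := u))"
      by (rule onb_extend[OF e])
    moreover have "cspan (insert u (cspan B)) = cspan (insert b B)"
    proof -
      have B: "x \<in> cspan (insert b B)" if "x \<in> cspan B" for x
        using that complex_vector.span_mono[OF subset_insertI] by blast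
      have "b \<in> cspan (insert b B)"
        by (simp add: complex_vector.span_base)
      then have "u \<in> cspan (insert b B)"
        unfolding u_def by (intro complex_vector.span_scale complex_vector.span_diff B[OF p])
      moreover have "b = complex_of_real (norm (b - p)) *\<^sub>C u + p"
        using False by (simp add: u_def scaleC_scaleC flip: of_real_mult)
      then have "b \<in> cspan (insert u (cspan B))"
        using p by (metis complex_vector.span_add complex_vector.span_base complex_vector.span_scale
            insertCI)
      ultimately show ?thesis
        unfolding complex_vector.span_eq
        using B complex_vector.span_base[of _ "insert u (cspan B)"] complex_vector.span_base[of _ B]
        by auto
    qed
    ultimately show ?thesis
      by auto
  qed
qed

lemma span_insert_orthogonal_complement:
  assumes M: "complex_vector.subspace M" and v: "v \<in> M" "norm v = 1"
  shows "cspan (insert v {x \<in> M. cinner v x = 0}) = M"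
proof
  show "cspan (insert v {x \<in> M. cinner v x = 0}) \<subseteq> M"
    using assms by (intro complex_vector.span_minimal) auto
  show "M \<subseteq> cspan (insert v {x \<in> M. cinner v x = 0})"
  proof
    fix x assume x: "x \<in> M"
    have "x - cinner v x *\<^sub>C v \<in> {x \<in> M. cinner v x = 0}"
      using x v M
      by (simp add: complex_vector.subspace_diff complex_vector.subspace_scale cinner_diff_right
          cinner_scaleC_right cinner_self)
    then have "(x - cinner v x *\<^sub>C v) + cinner v x *\<^sub>C v \<in> cspan (insert v {x \<in> M. cinner v x = 0})"
      by (intro complex_vector.span_add complex_vector.span_scale complex_vector.span_base) auto
    then show "x \<in> cspan (insert v {x \<in> M. cinner v x = 0})"
      by simp
  qed
qed

text \<open>Projecting the basis along \<open>v\<close> leaves \<open>Suc k\<close> spanning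
  vectors, one too many. The exact count comes from adding \<open>v\<close> back to an orthonormal
  basis of the complement and comparing cardinalities in \<open>M\<close>; the induction for
  singular vectors depends on it.\<close>

lemma onb_complement:
  assumes e: "orthonormal_basis_on M (Suc k) e" and v: "v \<in> M" "norm v = 1"
  shows "\<exists>f. orthonormal_basis_on {x \<in> M. cinner v x = 0} k f"
proof -
  have M: "complex_vector.subspace M"
    by (rule onb_subspace[OF e])
  let ?M' = "{x \<in> M. cinner v x = 0}"
  have M': "complex_vector.subspace ?M'"
    using M by (auto simp: complex_vector.subspace_def cinner_add_right cinner_scaleC_right)
  define \<pi> where "\<pi> x = x - cinner v x *\<^sub>C v" for x
  have \<pi>: "\<pi> x \<in> ?M'" if "x \<in> M" for x
    using that v M by (simp add: \<pi>_def complex_vector.subspace_diff complex_vector.subspace_scale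
        cinner_diff_right cinner_scaleC_right cinner_self)
  have "cspan (\<pi> ` e ` {..<Suc k}) = ?M'"
  proof
    show "cspan (\<pi> ` e ` {..<Suc k}) \<subseteq> ?M'"
      using \<pi> onb_mem[OF e] by (intro complex_vector.span_minimal M') blast
    show "?M' \<subseteq> cspan (\<pi> ` e ` {..<Suc k})"
    proof
      fix x assume x: "x \<in> ?M'"
      have "(\<Sum>j<Suc k. cinner (e j) x *\<^sub>C \<pi> (e j)) = \<pi> (\<Sum>j<Suc k. cinner (e j) x *\<^sub>C e j)"
        by (simp only: \<pi>_def cinner_sum_right cinner_scaleC_right complex_vector.scale_sum_left
            complex_vector.scale_right_diff_distrib sum_subtractf scaleC_scaleC)
      also have "\<dots> = x"
        using x onb_expand[OF e, of x] by (simp add: \<pi>_def)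
      finally have "x = (\<Sum>j<Suc k. cinner (e j) x *\<^sub>C \<pi> (e j))" by simp
      also have "\<dots> \<in> cspan (\<pi> ` e ` {..<Suc k})"
        by (intro complex_vector.span_sum complex_vector.span_scale complex_vector.span_base) auto
      finally show "x \<in> cspan (\<pi> ` e ` {..<Suc k})" .
    qed
  qed
  then obtain m f where f: "orthonormal_basis_on ?M' m f"
    using onb_exists[of "\<pi> ` e ` {..<Suc k}"] by auto
  have "orthonormal_basis_on M (Suc m) (f(m := v))"
    using onb_extend[OF f v(2)] span_insert_orthogonal_complement[OF M v] by simp
  then have "m = k"
    using onb_card_unique[OF e] by fastforce
  then show ?thesis
    using f by blast
qed

section \<open>Compactness of the unit sphere of a finite dimensional subspace\<close>

lemma bounded_linear_scaleC: "bounded_linear (\<lambda>c. c *\<^sub>C x)"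
  by (rule bounded_linear_intro[of _ "norm x"])
    (simp_all add: scaleC_add_left norm_scaleC scaleR_conv_of_real scaleC_of_real flip: scaleC_scaleC)

lemma closed_sphere_0: "closed (sphere 0 r :: 'a::real_normed_vector set)"
proof -
  have "sphere 0 r = {x::'a. norm x = r}"
    by auto
  then show ?thesis
    by (simp add: closed_Collect_eq continuous_on_norm_id)
qed

lemma compact_onb_sphere:
  assumes e: "orthonormal_basis_on M k e"
  shows "compact (M \<inter> sphere 0 1)"
proof -
  \<comment> \<open>The image of a polydisc of coefficients, built up one disc at a time, so that
    compactness follows by induction from products of two factors.\<close>
  define K where "K m = {x. \<exists>c. (\<forall>j<m. cmod (c j) \<le> 1) \<and> x = (\<Sum>j<m. c j *\<^sub>C e j)}" for m
  have "compact (K m)" for m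
  proof (induction m)
    case 0
    then show ?case
      by (simp add: K_def)
  next
    case (Suc m)
    have "K (Suc m) = (\<lambda>(x, a). x + a *\<^sub>C e m) ` (K m \<times> cball 0 1)"
    proof (intro subset_antisym subsetI)
      fix x assume "x \<in> K (Suc m)"
      then obtain c where "\<forall>j<Suc m. cmod (c j) \<le> 1" "x = (\<Sum>j<Suc m. c j *\<^sub>C e j)"
        by (auto simp: K_def)
      then show "x \<in> (\<lambda>(x, a). x + a *\<^sub>C e m) ` (K m \<times> cball 0 1)"
        by (intro image_eqI[of _ _ "(\<Sum>j<m. c j *\<^sub>C e j, c m)"])
          (auto simp: K_def intro!: exI[of _ c])
    next
      fix x assume "x \<in> (\<lambda>(x, a). x + a *\<^sub>C e m) ` (K m \<times> cball 0 1)"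
      then obtain c a where c: "\<forall>j<m. cmod (c j) \<le> 1" "cmod a \<le> 1"
        and x: "x = (\<Sum>j<m. c j *\<^sub>C e j) + a *\<^sub>C e m"
        by (auto simp: K_def)
      have "x = (\<Sum>j<Suc m. (c(m := a)) j *\<^sub>C e j)"
        by (simp add: x)
      moreover have "\<forall>j<Suc m. cmod ((c(m := a)) j) \<le> 1"
        using c by (simp add: less_Suc_eq)
      ultimately show "x \<in> K (Suc m)"
        unfolding K_def by blast
    qed
    moreover have "continuous_on UNIV (\<lambda>(x, a). x + a *\<^sub>C e m)"
      unfolding case_prod_unfold
      by (intro continuous_intros bounded_linear.continuous_on[OF bounded_linear_scaleC])
    ultimately show ?case
      using Suc by (metis compact_Times compact_cball compact_continuous_image continuous_on_subset
          subset_UNIV)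
  qed
  moreover have "M \<inter> sphere 0 1 = K k \<inter> sphere 0 1"
  proof (intro subset_antisym subsetI IntI)
    fix x assume x: "x \<in> M \<inter> sphere 0 1"
    then have "\<forall>j<k. cmod (cinner (e j) x) \<le> 1"
      using cinner_Cauchy_Schwarz[of _ x] onb_norm[OF e] by (metis IntD2 mem_sphere_0 mult_1)
    moreover have "x = (\<Sum>j<k. cinner (e j) x *\<^sub>C e j)"
      using onb_expand[OF e] x by simp
    ultimately show "x \<in> K k"
      unfolding K_def by (intro CollectI exI[of _ "\<lambda>j. cinner (e j) x"] conjI)
  qed (auto simp: K_def onb_sum_mem[OF e])
  ultimately show ?thesis
    by (metis compact_Int_closed closed_sphere_0)
qed

section \<open>Singular value decompositions\<close>

text \<open>The first vector is one where \<open>\<parallel>X v\<parallel>\<close> is maximal on the unit sphere of \<open>M\<close>; by maximality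
  \<open>X\<close> maps its orthogonal complement into that of \<open>X v\<close>.\<close>

lemma singular_vectors_exist:
  fixes X :: "'a::chilbert_space \<Rightarrow> 'a"
  assumes X: "bounded_op_on UNIV X" and "orthonormal_basis_on M k e" "orthonormal_basis_on N k f"
    and "X ` M \<subseteq> N"
  shows "\<exists>v u d. orthonormal_basis_on M k v \<and> orthonormal_basis_on N k u \<and>
    (\<forall>j<k. 0 \<le> d j) \<and> mono_on {..<k} d \<and> (\<forall>j<k. X (v j) = complex_of_real (d j) *\<^sub>C u j)"
  using assms(2-)
proof (induction k arbitrary: M N e f)
  case 0
  then show ?case
    by (auto simp: mono_on_def)
next
  case (Suc k)
  note e = Suc.prems(1) and f = Suc.prems(2) and XM = Suc.prems(3)
  have X': "bounded_linear X" and XC: "\<And>c x. X (c *\<^sub>C x) = c *\<^sub>C X x"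
    using X by (simp_all add: bounded_op_on_UNIV)
  interpret X: bounded_linear X by fact
  have M: "complex_vector.subspace M"
    by (rule onb_subspace[OF e])
  have "continuous_on (M \<inter> sphere 0 1) (\<lambda>x. norm (X x))"
    by (intro continuous_intros X.continuous_on)
  moreover have "e 0 \<in> M \<inter> sphere 0 1"
    using onb_mem[OF e, of 0] onb_norm[OF e, of 0] by simp
  ultimately have "\<exists>w\<in>M \<inter> sphere 0 1. \<forall>x\<in>M \<inter> sphere 0 1. norm (X x) \<le> norm (X w)"
    by (intro continuous_attains_sup compact_onb_sphere[OF e]) blast
  then obtain w where w: "w \<in> M" "norm w = 1"
    and max: "\<And>x. x \<in> M \<Longrightarrow> norm x = 1 \<Longrightarrow> norm (X x) \<le> norm (X w)"
    by auto
  define s where "s = norm (X w)"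
  have bound: "norm (X x) \<le> s * norm x" if "x \<in> M" for x
  proof (cases "x = 0")
    case False
    have "complex_of_real (1 / norm x) *\<^sub>C x \<in> M"
      using M that by (rule complex_vector.subspace_scale)
    then have "norm (X (complex_of_real (1 / norm x) *\<^sub>C x)) \<le> s"
      unfolding s_def using False by (intro max) (simp_all add: norm_scaleC norm_divide)
    then show ?thesis
      using False by (simp add: XC norm_scaleC norm_divide field_simps)
  qed (simp add: X.zero)
  show ?case
  \<comment> \<open>For \<open>s = 0\<close> there is no direction \<open>X w / s\<close>, but then
    \<open>X\<close> vanishes on \<open>M\<close> and any two bases serve.\<close>
  proof (cases "s = 0")
    case True
    then have "X (e j) = 0" if "j < Suc k" for j
      using bound[OF onb_mem[OF e that]] by simp
    then show ?thesis
      using e f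
      by - (rule exI[where x = e], rule exI[where x = f], rule exI[where x = "\<lambda>_. 0"],
          simp add: mono_on_def)
  next
    case False
    then have s: "s > 0"
      by (simp add: s_def)
    define y where "y = complex_of_real (1 / s) *\<^sub>C X w"
    have Xw: "X w = complex_of_real s *\<^sub>C y"
      using s by (simp add: y_def scaleC_scaleC flip: of_real_mult)
    have y: "y \<in> N" "norm y = 1"
      using XM w(1) s complex_vector.subspace_scale[OF onb_subspace[OF f]]
      by (auto simp: y_def norm_scaleC norm_divide s_def)
    define M' where "M' = {x \<in> M. cinner w x = 0}"
    define N' where "N' = {x \<in> N. cinner y x = 0}"
    have inner0: "X w \<bullet> X x = 0" if "x \<in> M'" for x
    proof -
      \<comment> \<open>Maximality of \<open>w\<close> compares the norms of \<open>X\<close> along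
        the line \<open>w + t *\<^sub>R x\<close>; a maximum instead of a minimum accounts for the
        minus sign.\<close>
      have "2 * t * (- (X w \<bullet> X x)) + t\<^sup>2 * (s\<^sup>2 * (norm x)\<^sup>2) \<ge> 0" for t
      proof -
        have wx: "w \<bullet> x = 0"
          using that by (simp add: M'_def flip: Re_cinner)
        have "complex_of_real t *\<^sub>C x \<in> M"
          using M that by (simp add: M'_def complex_vector.subspace_scale)
        then have "w + t *\<^sub>R x \<in> M"
          using complex_vector.subspace_add[OF M w(1)] by (simp add: scaleC_of_real)
        then have le: "(norm (X (w + t *\<^sub>R x)))\<^sup>2 \<le> s\<^sup>2 * (norm (w + t *\<^sub>R x))\<^sup>2"
          using power_mono[OF bound norm_ge_zero, of "w + t *\<^sub>R x" 2] by (simp only: power_mult_distrib)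
        have "(norm (X (w + t *\<^sub>R x)))\<^sup>2 = s\<^sup>2 + 2 * t * (X w \<bullet> X x) + t\<^sup>2 * (norm (X x))\<^sup>2"
          unfolding X.add X.scaleR s_def power2_norm_eq_inner
          by (simp add: inner_commute algebra_simps power2_eq_square)
        moreover have "(norm (w + t *\<^sub>R x))\<^sup>2 = 1 + t\<^sup>2 * (norm x)\<^sup>2"
          using w(2) wx unfolding power2_norm_eq_inner norm_eq_1
          by (simp add: inner_commute algebra_simps power2_eq_square)
        ultimately have "s\<^sup>2 + 2 * t * (X w \<bullet> X x) + t\<^sup>2 * (norm (X x))\<^sup>2 \<le> s\<^sup>2 * (1 + t\<^sup>2 * (norm x)\<^sup>2)"
          using le by (simp only:)
        then have "s\<^sup>2 + 2 * t * (X w \<bullet> X x) + t\<^sup>2 * (norm (X x))\<^sup>2 \<le> s\<^sup>2 + t\<^sup>2 * (s\<^sup>2 * (norm x)\<^sup>2)"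
          by (simp only: distrib_left mult_1_right mult.left_commute)
        moreover have "0 \<le> t\<^sup>2 * (norm (X x))\<^sup>2"
          by simp
        ultimately show ?thesis
          by linarith
      qed
      then show ?thesis
        using linear_coeff_zero_if_quadratic_nonneg[of "s\<^sup>2 * (norm x)\<^sup>2" "- (X w \<bullet> X x)"] by simp
    qed
    have "X ` M' \<subseteq> N'"
    proof
      fix z assume "z \<in> X ` M'"
      then obtain x where x: "x \<in> M'" "z = X x" by blast
      \<comment> \<open>\<open>M'\<close> is a complex subspace, so the real orthogonality at this
        multiple supplies the imaginary part.\<close>
      have "(- \<i>) *\<^sub>C x \<in> M'"
        using x(1) complex_vector.subspace_scale[OF M, of x "- \<i>"]
        unfolding M'_def mem_Collect_eq cinner_scaleC_right by auto
      then have "X w \<bullet> ((- \<i>) *\<^sub>C X x) = 0"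
        unfolding XC[symmetric] by (rule inner0)
      then have "cinner (X w) (X x) = 0"
        using inner0[OF x(1)] unfolding complex_eq_iff Re_cinner Im_cinner inner_scaleC_left by simp
      then have "cinner y (X x) = 0"
        using s by (simp add: Xw cinner_scaleC_left)
      then show "z \<in> N'"
        using x XM by (auto simp: N'_def M'_def)
    qed
    moreover obtain e' f' where "orthonormal_basis_on M' k e'" "orthonormal_basis_on N' k f'"
      using onb_complement[OF e w] onb_complement[OF f y] unfolding M'_def N'_def by blast
    ultimately have "\<exists>v u d. orthonormal_basis_on M' k v \<and> orthonormal_basis_on N' k u \<and>
        (\<forall>j<k. 0 \<le> d j) \<and> mono_on {..<k} d \<and> (\<forall>j<k. X (v j) = complex_of_real (d j) *\<^sub>C u j)"
      by (intro Suc.IH)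
    then obtain v u d where v: "orthonormal_basis_on M' k v" and u: "orthonormal_basis_on N' k u"
      and d: "\<forall>j<k. 0 \<le> d j" "mono_on {..<k} d"
      and Xv: "\<forall>j<k. X (v j) = complex_of_real (d j) *\<^sub>C u j"
      by (elim exE conjE) (rule that)
    \<comment> \<open>The maximal value \<open>s\<close> goes to the last index because
      \<open>d\<close> has to increase.\<close>
    have "orthonormal_basis_on M (Suc k) (v(k := w))"
      using onb_extend[OF v w(2)] span_insert_orthogonal_complement[OF M w] by (simp add: M'_def)
    moreover have "orthonormal_basis_on N (Suc k) (u(k := y))"
      using onb_extend[OF u y(2)] span_insert_orthogonal_complement[OF onb_subspace[OF f] y]
      by (simp add: N'_def)
    moreover have "d j \<le> s" if "j < k" for j
    proof -
      have "v j \<in> M"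
        using onb_mem[OF v that] by (simp add: M'_def)
      then show ?thesis
        using bound[of "v j"] Xv d(1) that onb_norm[OF v that] onb_norm[OF u that]
        by (simp add: norm_scaleC)
    qed
    then have "mono_on {..<Suc k} (d(k := s))"
      using d(2) by (auto simp: mono_on_def less_Suc_eq)
    ultimately show ?thesis
      using s d(1) Xv Xw
      by - (rule exI[where x = "v(k := w)"], rule exI[where x = "u(k := y)"],
          rule exI[where x = "d(k := s)"], simp add: less_Suc_eq fun_upd_def)
  qed
qed

text \<open>The sum of the rank one operators \<open>d j |u j><v j|\<close>, with left and right
  singular vectors in place of unitaries. An operator, its regularization and its Moore-Penrose
  inverse then differ only in \<open>d\<close> and in the order of the bases.\<close>

definition sv_op :: "nat \<Rightarrow> (nat \<Rightarrow> 'a) \<Rightarrow> (nat \<Rightarrow> real) \<Rightarrow> (nat \<Rightarrow> 'a) \<Rightarrow> 'a \<Rightarrow> 'a::chilbert_space"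
  where "sv_op k u d v x = (\<Sum>j<k. (complex_of_real (d j) * cinner (v j) x) *\<^sub>C u j)"

lemma sv_op_add: "sv_op k u d v (x + y) = sv_op k u d v x + sv_op k u d v y"
  by (simp add: sv_op_def cinner_add_right distrib_left scaleC_add_left sum.distrib)

lemma sv_op_scale: "sv_op k u d v (c *\<^sub>C x) = c *\<^sub>C sv_op k u d v x"
  by (simp add: sv_op_def cinner_scaleC_right complex_vector.scale_sum_right scaleC_scaleC mult_ac)

lemma sv_op_mem: "orthonormal_basis_on M k u \<Longrightarrow> sv_op k u d v x \<in> M"
  unfolding sv_op_def by (rule onb_sum_mem)

lemma sv_op_coeff:
  "orthonormal_basis_on M k u \<Longrightarrow> j < k \<Longrightarrow>
    cinner (u j) (sv_op k u d v x) = complex_of_real (d j) * cinner (v j) x"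
  unfolding sv_op_def by (rule onb_coeff)

lemma norm_sv_op:
  assumes "orthonormal_basis_on M k u"
  shows "(norm (sv_op k u d v x))\<^sup>2 = (\<Sum>j<k. (d j)\<^sup>2 * (cmod (cinner (v j) x))\<^sup>2)"
  unfolding sv_op_def onb_norm_sum[OF assms] by (simp add: norm_mult power_mult_distrib)

lemma norm_sv_op_le:
  assumes u: "orthonormal_basis_on M k u" and v: "orthonormal_basis_on M k v"
    and d: "\<And>j. j < k \<Longrightarrow> \<bar>d j\<bar> \<le> K" and "0 \<le> K" "x \<in> M"
  shows "norm (sv_op k u d v x) \<le> K * norm x"
proof -
  have "(norm (sv_op k u d v x))\<^sup>2 \<le> (\<Sum>j<k. K\<^sup>2 * (cmod (cinner (v j) x))\<^sup>2)"
    unfolding norm_sv_op[OF u] using d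
    by (intro sum_mono mult_right_mono) (simp_all add: abs_le_square_iff[symmetric] \<open>0 \<le> K\<close>)
  also have "\<dots> = (K * norm x)\<^sup>2"
    unfolding power_mult_distrib onb_parseval[OF v \<open>x \<in> M\<close>] by (simp add: sum_distrib_left)
  finally show ?thesis
    by (rule power2_le_imp_le) (use \<open>0 \<le> K\<close> in simp)
qed

lemma sv_op_bounded_op:
  assumes u: "orthonormal_basis_on M k u" and v: "orthonormal_basis_on M k v"
  shows "bounded_op_on M (sv_op k u d v)"
proof -
  have "norm (sv_op k u d v x) \<le> norm x * (\<Sum>j<k. \<bar>d j\<bar>)" if "x \<in> M" for x
    unfolding mult.commute[of "norm x"]
    by (intro norm_sv_op_le[OF u v _ _ that] member_le_sum) (auto simp: sum_nonneg)
  then show ?thesis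
    unfolding bounded_op_on_def using sv_op_mem[OF u] by (auto simp: sv_op_add sv_op_scale)
qed

lemma sv_op_compose:
  assumes "orthonormal_basis_on M k u"
  shows "sv_op k w d' u (sv_op k u d v x) = sv_op k w (\<lambda>j. d' j * d j) v x"
  unfolding sv_op_def[of k w]
  by (intro sum.cong) (simp_all add: sv_op_coeff[OF assms] mult.assoc)

lemma sv_op_selfadjoint: "selfadjoint_on M (sv_op k u d u)"
  unfolding is_adjoint_on_def sv_op_def cinner_sum_left cinner_sum_right cinner_scaleC_left
    cinner_scaleC_right
  by (intro ballI sum.cong) (simp_all, metis cinner_commute)

text \<open>Zero singular values are covered as well, since \<open>inverse 0 = 0\<close>.\<close>

lemma sv_op_mp_inverse:
  assumes u: "orthonormal_basis_on M k u" and v: "orthonormal_basis_on M k v"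
  shows "is_mp_inverse_on M (sv_op k u d v) (sv_op k v (\<lambda>j. inverse (d j)) u)"
proof -
  have "(\<lambda>j. d j * inverse (d j) * d j) = d" "(\<lambda>j. inverse (d j) * d j * inverse (d j)) = (\<lambda>j. inverse (d j))"
    by (auto simp: field_simps)
  then show ?thesis
    unfolding is_mp_inverse_on_def
    using sv_op_bounded_op[OF v u]
    by (simp add: sv_op_selfadjoint sv_op_compose[OF u] sv_op_compose[OF v] mult.assoc[symmetric])
qed

lemma sv_op_eq_of_images:
  assumes X: "bounded_linear X" "\<And>c x. X (c *\<^sub>C x) = c *\<^sub>C X x"
    and v: "orthonormal_basis_on M k v" and Xv: "\<And>j. j < k \<Longrightarrow> X (v j) = complex_of_real (d j) *\<^sub>C u j"
    and x: "x \<in> M"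
  shows "X x = sv_op k u d v x"
proof -
  interpret X: bounded_linear X by fact
  have "X x = X (\<Sum>j<k. cinner (v j) x *\<^sub>C v j)"
    by (simp only: onb_expand[OF v x])
  also have "\<dots> = sv_op k u d v x"
    unfolding X.sum X(2) sv_op_def by (intro sum.cong) (simp_all add: Xv scaleC_scaleC mult.commute)
  finally show ?thesis .
qed

text \<open>The basis in a decomposition is free, so the left singular vectors are taken for it; the
  left unitary becomes \<open>id\<close>, and \<open>V\<close> carries the right singular vectors to
  the left ones.\<close>

lemma svd_exists:
  assumes X: "bounded_op_on UNIV X" and e: "orthonormal_basis_on M k e" and XM: "X ` M \<subseteq> M"
  shows "\<exists>u d V. is_svd_on M X k u id d V"
proof -
  obtain v u d where v: "orthonormal_basis_on M k v" and u: "orthonormal_basis_on M k u"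
    and d: "\<forall>j<k. 0 \<le> d j" "mono_on {..<k} d"
    and Xv: "\<forall>j<k. X (v j) = complex_of_real (d j) *\<^sub>C u j"
    using singular_vectors_exist[OF X e e XM] by (elim exE conjE) (rule that)
  define V where "V = sv_op k u (\<lambda>_. 1) v"
  have inv: "V (sv_op k v (\<lambda>_. 1) u y) = y" if "y \<in> M" for y
    using onb_expand[OF u that] unfolding V_def sv_op_compose[OF v] by (simp add: sv_op_def)
  have "unitary_on M V"
    unfolding unitary_on_def
  proof (intro conjI ballI)
    show "bounded_op_on M V"
      unfolding V_def by (rule sv_op_bounded_op[OF u v])
    show "V ` M = M"
    proof (intro subset_antisym subsetI)
      show "y \<in> V ` M" if "y \<in> M" for y
        using inv[OF that] sv_op_mem[OF v] by (metis imageI)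
    qed (auto simp: V_def sv_op_mem[OF u])
    show "cinner (V x) (V y) = cinner x y" if "x \<in> M" "y \<in> M" for x y
    proof -
      have "cinner (V x) (V y) = cinner (\<Sum>j<k. cinner (v j) x *\<^sub>C v j) (\<Sum>j<k. cinner (v j) y *\<^sub>C v j)"
        unfolding V_def sv_op_def onb_cinner_sum[OF u] onb_cinner_sum[OF v] by simp
      then show ?thesis
        by (simp only: onb_expand[OF v that(1)] onb_expand[OF v that(2)])
    qed
  qed
  moreover have "unitary_on M id"
    unfolding unitary_on_def bounded_op_on_def by (auto intro: exI[of _ 1])
  moreover have "X x = diag_op k u d (V x)" if "x \<in> M" for x
  proof -
    have "X x = sv_op k u d v x"
      using X Xv by (intro sv_op_eq_of_images[OF _ _ v _ that]) (simp_all add: bounded_op_on_UNIV)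
    also have "\<dots> = diag_op k u d (V x)"
      unfolding V_def diag_op_def sv_op_def[of k u d]
      by (intro sum.cong) (simp_all add: sv_op_coeff[OF u])
    finally show ?thesis .
  qed
  ultimately have "is_svd_on M X k u id d V"
    unfolding is_svd_on_def using u d by simp
  then show ?thesis by blast
qed

section \<open>From unitary factors back to singular vectors\<close>

lemma unitary_image_onb:
  assumes U: "unitary_on M U" and e: "orthonormal_basis_on M k e"
  shows "orthonormal_basis_on M k (\<lambda>j. U (e j))"
    and "U (\<Sum>j<k. c j *\<^sub>C e j) = (\<Sum>j<k. c j *\<^sub>C U (e j))"
proof -
  have add: "\<And>x y. x \<in> M \<Longrightarrow> y \<in> M \<Longrightarrow> U (x + y) = U x + U y"
    and scale: "\<And>c x. x \<in> M \<Longrightarrow> U (c *\<^sub>C x) = c *\<^sub>C U x"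
    and UM: "U ` M = M" and iso: "\<And>x y. x \<in> M \<Longrightarrow> y \<in> M \<Longrightarrow> cinner (U x) (U y) = cinner x y"
    using U by (auto simp: unitary_on_def bounded_op_on_def)
  have M: "complex_vector.subspace M"
    by (rule onb_subspace[OF e])
  have sum: "U (\<Sum>j<m. c j *\<^sub>C e j) = (\<Sum>j<m. c j *\<^sub>C U (e j))" if "m \<le> k" for m c
    using that
  proof (induction m)
    case 0
    have "U (0 *\<^sub>C 0) = 0 *\<^sub>C U 0"
      using complex_vector.subspace_0[OF M] by (rule scale)
    then show ?case by simp
  next
    case (Suc m)
    have "(\<Sum>j<m. c j *\<^sub>C e j) \<in> M" "c m *\<^sub>C e m \<in> M"
      using Suc.prems
      by (auto intro!: complex_vector.subspace_sum[OF M] complex_vector.subspace_scale[OF M] onb_mem[OF e])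
    then show ?case
      using Suc by (simp add: add scale onb_mem[OF e])
  qed
  then show "U (\<Sum>j<k. c j *\<^sub>C e j) = (\<Sum>j<k. c j *\<^sub>C U (e j))"
    by simp
  have mem: "U (e j) \<in> M" if "j < k" for j
    using UM onb_mem[OF e that] by blast
  have "cspan ((\<lambda>j. U (e j)) ` {..<k}) = M"
  proof
    show "cspan ((\<lambda>j. U (e j)) ` {..<k}) \<subseteq> M"
      using mem by (intro complex_vector.span_minimal M) auto
    show "M \<subseteq> cspan ((\<lambda>j. U (e j)) ` {..<k})"
    proof
      fix y assume "y \<in> M"
      then obtain x where x: "x \<in> M" "y = U x"
        using UM by blast
      have "y = U (\<Sum>j<k. cinner (e j) x *\<^sub>C e j)"
        by (simp only: x(2) onb_expand[OF e x(1)])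
      also have "\<dots> = (\<Sum>j<k. cinner (e j) x *\<^sub>C U (e j))"
        by (simp add: sum)
      also have "\<dots> \<in> cspan ((\<lambda>j. U (e j)) ` {..<k})"
        by (intro complex_vector.span_sum complex_vector.span_scale complex_vector.span_base) auto
      finally show "y \<in> cspan ((\<lambda>j. U (e j)) ` {..<k})" .
    qed
  qed
  then show "orthonormal_basis_on M k (\<lambda>j. U (e j))"
    unfolding orthonormal_basis_on_def by (simp add: iso onb_mem[OF e] onb_cinner[OF e])
qed

text \<open>The \<open>v j\<close> are the preimages of the \<open>e j\<close>. They span because a
  vector orthogonal to all of them has an image orthogonal to every \<open>e j\<close>, hence
  zero.\<close>

lemma unitary_preimage_onb:
  assumes V: "unitary_on M V" and e: "orthonormal_basis_on M k e"
  shows "\<exists>v. orthonormal_basis_on M k v \<and> (\<forall>j<k. \<forall>x\<in>M. cinner (e j) (V x) = cinner (v j) x)"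
proof -
  have VM: "V ` M = M" and iso: "\<And>x y. x \<in> M \<Longrightarrow> y \<in> M \<Longrightarrow> cinner (V x) (V y) = cinner x y"
    using V by (auto simp: unitary_on_def)
  define W where "W y = (SOME x. x \<in> M \<and> V x = y)" for y
  have W: "W y \<in> M" "V (W y) = y" if "y \<in> M" for y
  proof -
    have "y \<in> V ` M"
      using that by (simp only: VM)
    then have "\<exists>x. x \<in> M \<and> V x = y"
      by blast
    then have "W y \<in> M \<and> V (W y) = y"
      unfolding W_def by (rule someI_ex)
    then show "W y \<in> M" "V (W y) = y" by auto
  qed
  have adj: "cinner y (V x) = cinner (W y) x" if "x \<in> M" "y \<in> M" for x y
    using iso[OF W(1)[OF that(2)] that(1)] W(2)[OF that(2)] by simp
  have orth: "cinner (W (e i)) (W (e j)) = (if i = j then 1 else 0)" if "i < k" "j < k" for i j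
    using that adj[of "W (e j)" "e i"] W onb_mem[OF e] by (simp add: onb_cinner[OF e])
  have M: "complex_vector.subspace M"
    by (rule onb_subspace[OF e])
  have "cspan ((\<lambda>j. W (e j)) ` {..<k}) = M"
  proof
    show "cspan ((\<lambda>j. W (e j)) ` {..<k}) \<subseteq> M"
      using W onb_mem[OF e] by (intro complex_vector.span_minimal M) auto
    then have W': "orthonormal_basis_on (cspan ((\<lambda>j. W (e j)) ` {..<k})) k (\<lambda>j. W (e j))"
      unfolding orthonormal_basis_on_def by (simp add: orth)
    show "M \<subseteq> cspan ((\<lambda>j. W (e j)) ` {..<k})"
    proof
      fix x assume x: "x \<in> M"
      define z where "z = x - (\<Sum>j<k. cinner (W (e j)) x *\<^sub>C W (e j))"
      have z: "z \<in> M"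
        using x W onb_mem[OF e] unfolding z_def
        by (intro complex_vector.subspace_diff[OF M] complex_vector.subspace_sum[OF M]
            complex_vector.subspace_scale[OF M]) auto
      have "cinner (e j) (V z) = 0" if "j < k" for j
        unfolding adj[OF z onb_mem[OF e that]]
        unfolding z_def cinner_diff_right using onb_coeff[OF W' that] by simp
      moreover have "V z \<in> M"
        using VM z by blast
      ultimately have "V z = 0"
        using onb_expand[OF e, of "V z"] by simp
      then have "cinner z z = 0"
        using iso[OF z z] by simp
      then have "z = 0"
        by (simp add: cinner_self)
      then have "x = (\<Sum>j<k. cinner (W (e j)) x *\<^sub>C W (e j))"
        by (simp add: z_def)
      then show "x \<in> cspan ((\<lambda>j. W (e j)) ` {..<k})"
        using onb_sum_mem[OF W'] by metis
    qed
  qed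
  then have "orthonormal_basis_on M k (\<lambda>j. W (e j))"
    unfolding orthonormal_basis_on_def by (simp add: orth)
  then show ?thesis
    using adj onb_mem[OF e] by (intro exI[of _ "\<lambda>j. W (e j)"]) blast
qed

text \<open>The bases are chosen before \<open>d'\<close>: the same singular vectors describe the
  operator and every modification of its singular values.\<close>

lemma svd_sv_op:
  assumes "is_svd_on M S k e U d V"
  shows "\<exists>u v. orthonormal_basis_on M k u \<and> orthonormal_basis_on M k v \<and>
    (\<forall>d'. \<forall>x\<in>M. U (diag_op k e d' (V x)) = sv_op k u d' v x)"
proof -
  have e: "orthonormal_basis_on M k e" and U: "unitary_on M U" and V: "unitary_on M V"
    using assms by (auto simp: is_svd_on_def)
  obtain v where v: "orthonormal_basis_on M k v"
    and ev: "\<And>j x. j < k \<Longrightarrow> x \<in> M \<Longrightarrow> cinner (e j) (V x) = cinner (v j) x"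
    using unitary_preimage_onb[OF V e] by blast
  have "U (diag_op k e d' (V x)) = sv_op k (\<lambda>j. U (e j)) d' v x" if "x \<in> M" for d' x
    unfolding diag_op_def unitary_image_onb(2)[OF U e] sv_op_def using ev[OF _ that]
    by (intro sum.cong) simp_all
  then show ?thesis
    using v unitary_image_onb(1)[OF U e] by blast
qed

text \<open>The constructed decomposition only shows that a regularization exists. The singular
  vectors in the conclusion are those of the decomposition behind the value picked by
  \<open>SOME\<close>, so they fit \<open>X\<close> and that value simultaneously.\<close>

lemma regularization_sv_op:
  assumes X: "bounded_op_on UNIV X" and e: "orthonormal_basis_on M m e" and XM: "X ` M \<subseteq> M"
  shows "\<exists>k u v d. orthonormal_basis_on M k u \<and> orthonormal_basis_on M k v \<and> (\<forall>j<k. 0 \<le> d j) \<and>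
    (\<forall>x\<in>M. X x = sv_op k u d v x) \<and>
    (\<forall>x\<in>M. regularization_on M \<epsilon> X x = sv_op k u (\<lambda>j. if d j \<le> \<epsilon> then 0 else d j) v x)"
proof -
  obtain u d V where "is_svd_on M X m u id d V"
    using svd_exists[OF assms] by blast
  then have "is_regularization_on M \<epsilon> X
      (\<lambda>x. id (diag_op m u (\<lambda>j. if d j \<le> \<epsilon> then 0 else d j) (V x)))"
    unfolding is_regularization_on_def by - ((rule exI)+, rule conjI, assumption, simp)
  then have "\<exists>R. is_regularization_on M \<epsilon> X R"
    by blast
  then have "is_regularization_on M \<epsilon> X (regularization_on M \<epsilon> X)"
    unfolding regularization_on_def by (rule someI_ex)
  then obtain k e U d V where svd: "is_svd_on M X k e U d V"
    and R: "\<forall>x\<in>M. regularization_on M \<epsilon> X x = U (diag_op k e (\<lambda>j. if d j \<le> \<epsilon> then 0 else d j) (V x))"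
    unfolding is_regularization_on_def by blast
  have d: "\<forall>j<k. 0 \<le> d j" and XUV: "\<forall>x\<in>M. X x = U (diag_op k e d (V x))"
    using svd by (simp_all add: is_svd_on_def)
  obtain u v where uv: "orthonormal_basis_on M k u" "orthonormal_basis_on M k v"
    and sv: "\<And>d' x. x \<in> M \<Longrightarrow> U (diag_op k e d' (V x)) = sv_op k u d' v x"
    using svd_sv_op[OF svd] by blast
  have "\<forall>x\<in>M. X x = sv_op k u d v x"
    and "\<forall>x\<in>M. regularization_on M \<epsilon> X x = sv_op k u (\<lambda>j. if d j \<le> \<epsilon> then 0 else d j) v x"
    using XUV R sv by simp_all
  with uv d show ?thesis
    by blast
qed

section \<open>Norms of compressions and of their inverses\<close>

lemma bounded_op_on_bound: "bounded_op_on M X \<Longrightarrow> \<exists>K. \<forall>x\<in>M. norm (X x) \<le> norm x * K"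
  by (simp only: bounded_op_on_def)

lemma op_norm_on_bdd_above:
  assumes "bounded_op_on M X"
  shows "bdd_above ((\<lambda>x. norm (X x) / norm x) ` M)"
proof -
  obtain K where K: "\<And>x. x \<in> M \<Longrightarrow> norm (X x) \<le> norm x * K"
    using bounded_op_on_bound[OF assms] by blast
  show ?thesis
  \<comment> \<open>At \<open>x = 0\<close> the quotient is 0 by the convention for division, and
    \<open>K\<close> may be negative on the zero space; hence the bound
    \<open>max K 0\<close>.\<close>
  proof (rule bdd_aboveI2)
    fix x assume "x \<in> M"
    moreover have "norm x * K \<le> norm x * max K 0"
      by (intro mult_left_mono) auto
    ultimately have "norm (X x) \<le> norm x * max K 0"
      using K order_trans by blast
    then show "norm (X x) / norm x \<le> max K 0"
      by (cases "x = 0") (simp_all add: divide_le_eq mult.commute)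
  qed
qed

lemma le_op_norm_on:
  assumes X: "bounded_op_on M X" and x: "x \<in> M"
  shows "norm (X x) \<le> op_norm_on M X * norm x"
proof (cases "x = 0")
  case True
  obtain K where K: "\<And>x. x \<in> M \<Longrightarrow> norm (X x) \<le> norm x * K"
    using bounded_op_on_bound[OF X] by blast
  show ?thesis
    using K[OF x] True by simp
next
  case False
  have "norm (X x) / norm x \<le> op_norm_on M X"
    unfolding op_norm_on_def using x op_norm_on_bdd_above[OF X] by (rule cSUP_upper)
  then show ?thesis
    using False by (simp add: divide_le_eq)
qed

lemma op_norm_on_le:
  assumes "M \<noteq> {}" "0 \<le> K" "\<And>x. x \<in> M \<Longrightarrow> norm (X x) \<le> K * norm x"
  shows "op_norm_on M X \<le> K"
  unfolding op_norm_on_def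
proof (rule cSUP_least)
  fix x assume "x \<in> M"
  then show "norm (X x) / norm x \<le> K"
    using assms(2) assms(3)[of x] by (cases "x = 0") (auto simp: divide_le_eq)
qed (rule assms(1))

lemma op_norm_on_nonneg:
  assumes "bounded_op_on M X" "M \<noteq> {}"
  shows "0 \<le> op_norm_on M X"
proof -
  obtain x where "x \<in> M"
    using assms(2) by blast
  then have "norm (X x) / norm x \<le> op_norm_on M X"
    unfolding op_norm_on_def using op_norm_on_bdd_above[OF assms(1)] by (rule cSUP_upper)
  then show ?thesis
    by (meson divide_nonneg_nonneg norm_ge_zero order_trans)
qed

lemma op_norm_on_cong: "(\<And>x. x \<in> M \<Longrightarrow> X x = Y x) \<Longrightarrow> op_norm_on M X = op_norm_on M Y"
  unfolding op_norm_on_def by (intro arg_cong[where f = Sup] image_cong) auto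

lemma inv_into_eq_inverse:
  assumes "bounded_op_on M Y" "\<And>x. x \<in> M \<Longrightarrow> X (Y x) = x \<and> Y (X x) = x" "x \<in> M"
  shows "inv_into M X x = Y x"
proof (rule inv_into_f_eq)
  show "inj_on X M"
    using assms(2) by (metis inj_onI)
  show "Y x \<in> M"
    using assms(1,3) by (auto simp: bounded_op_on_def)
qed (simp add: assms)

text \<open>The limit arguments reach inverse norms through this equivalence, which trades an
  extended real for a lower bound on \<open>X\<close>; the value \<open>\<infinity>\<close> makes
  both sides false.\<close>

lemma inv_norm_on_le_iff:
  assumes X: "bounded_op_on M X" and M: "M \<noteq> {}" and K: "0 \<le> K"
  shows "inv_norm_on M X \<le> ereal K \<longleftrightarrow> invertible_on M X \<and> (\<forall>x\<in>M. norm x \<le> K * norm (X x))"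
proof (cases "invertible_on M X")
  case True
  then obtain Y where Y: "bounded_op_on M Y" and inv: "\<And>x. x \<in> M \<Longrightarrow> X (Y x) = x \<and> Y (X x) = x"
    by (auto simp: invertible_on_def)
  have eq: "op_norm_on M (inv_into M X) = op_norm_on M Y"
    using inv_into_eq_inverse[OF Y inv] by (intro op_norm_on_cong)
  have XM: "X x \<in> M" and YM: "Y x \<in> M" if "x \<in> M" for x
    using X Y that by (auto simp: bounded_op_on_def)
  have "op_norm_on M Y \<le> K \<longleftrightarrow> (\<forall>x\<in>M. norm x \<le> K * norm (X x))"
  proof
    assume le: "op_norm_on M Y \<le> K"
    show "\<forall>x\<in>M. norm x \<le> K * norm (X x)"
    proof
      fix x assume x: "x \<in> M"
      have "norm x \<le> op_norm_on M Y * norm (X x)"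
        using le_op_norm_on[OF Y XM[OF x]] inv[OF x] by simp
      also have "\<dots> \<le> K * norm (X x)"
        using le by (rule mult_right_mono) simp
      finally show "norm x \<le> K * norm (X x)" .
    qed
  next
    assume le: "\<forall>x\<in>M. norm x \<le> K * norm (X x)"
    show "op_norm_on M Y \<le> K"
    proof (rule op_norm_on_le[OF M K])
      fix x assume "x \<in> M"
      then show "norm (Y x) \<le> K * norm x"
        using le YM inv by metis
    qed
  qed
  then show ?thesis
    using True by (simp add: inv_norm_on_def eq)
next
  case False
  then show ?thesis
    by (simp add: inv_norm_on_def)
qed

lemma inv_norm_on_nonneg:
  assumes "M \<noteq> {}"
  shows "0 \<le> inv_norm_on M X"
proof (cases "invertible_on M X")
  case True
  then obtain Y where Y: "bounded_op_on M Y" and inv: "\<And>x. x \<in> M \<Longrightarrow> X (Y x) = x \<and> Y (X x) = x"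
    by (auto simp: invertible_on_def)
  have "op_norm_on M (inv_into M X) = op_norm_on M Y"
    using inv_into_eq_inverse[OF Y inv] by (intro op_norm_on_cong)
  then show ?thesis
    using op_norm_on_nonneg[OF Y assms] True by (simp add: inv_norm_on_def)
qed (simp add: inv_norm_on_def)

lemma sv_op_cong: "(\<And>j. j < k \<Longrightarrow> d j = d' j) \<Longrightarrow> sv_op k u d v = sv_op k u d' v"
  unfolding sv_op_def by (intro ext sum.cong) auto

lemma sv_op_one: "orthonormal_basis_on M k u \<Longrightarrow> x \<in> M \<Longrightarrow> sv_op k u (\<lambda>_. 1) u x = x"
  using onb_expand[of M k u x] by (simp add: sv_op_def)

lemma sv_op_right_basis:
  assumes v: "orthonormal_basis_on M k v" and "j < k"
  shows "sv_op k u d v (v j) = complex_of_real (d j) *\<^sub>C u j"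
proof -
  have "sv_op k u d v (v j) = (\<Sum>i<k. if j = i then complex_of_real (d i) *\<^sub>C u i else 0)"
    unfolding sv_op_def using assms by (intro sum.cong) (auto simp: onb_cinner[OF v])
  also have "\<dots> = complex_of_real (d j) *\<^sub>C u j"
    using assms(2) by simp
  finally show ?thesis .
qed

lemma le_op_norm_sv_op:
  assumes u: "orthonormal_basis_on M k u" and v: "orthonormal_basis_on M k v" and j: "j < k"
  shows "\<bar>d j\<bar> \<le> op_norm_on M (sv_op k u d v)"
  using le_op_norm_on[OF sv_op_bounded_op[OF u v] onb_mem[OF v j], of d]
  by (simp add: sv_op_right_basis[OF v j] norm_scaleC onb_norm[OF u j] onb_norm[OF v j])

lemma onb_nonempty: "orthonormal_basis_on M k e \<Longrightarrow> M \<noteq> {}"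
  using onb_sum_mem by blast

lemma op_norm_sv_op_le:
  assumes u: "orthonormal_basis_on M k u" and v: "orthonormal_basis_on M k v"
    and d: "\<And>j. j < k \<Longrightarrow> \<bar>d j\<bar> \<le> K" and K: "0 \<le> K"
  shows "op_norm_on M (sv_op k u d v) \<le> K"
  by (intro op_norm_on_le onb_nonempty[OF u] K norm_sv_op_le[OF u v d])

text \<open>The lower bound excludes the singular value 0, so the reciprocal singular values with
  exchanged bases define the inverse.\<close>

lemma invertible_on_finite_dim:
  assumes X: "bounded_op_on UNIV X" and e: "orthonormal_basis_on M m e" and XM: "X ` M \<subseteq> M"
    and K: "\<And>x. x \<in> M \<Longrightarrow> norm x \<le> K * norm (X x)"
  shows "invertible_on M X"
proof -
  obtain k u v d where u: "orthonormal_basis_on M k u" and v: "orthonormal_basis_on M k v"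
    and X: "\<forall>x\<in>M. X x = sv_op k u d v x"
    using regularization_sv_op[OF X e XM, of 0] by blast
  have d: "d j \<noteq> 0" if "j < k" for j
  proof
    assume "d j = 0"
    then have "norm (v j) \<le> 0"
      using K[OF onb_mem[OF v that]] X onb_mem[OF v that] by (simp add: sv_op_right_basis[OF v that])
    then show False
      using onb_norm[OF v that] by simp
  qed
  define Y where "Y = sv_op k v (\<lambda>j. inverse (d j)) u"
  have Y: "Y x \<in> M" for x
    unfolding Y_def by (rule sv_op_mem[OF v])
  have "X (Y x) = x \<and> Y (X x) = x" if x: "x \<in> M" for x
  proof
    have "X (Y x) = sv_op k u (\<lambda>_. 1) u x"
      using X Y d by (simp add: Y_def sv_op_compose[OF v] cong: sv_op_cong)
    then show "X (Y x) = x"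
      by (simp only: sv_op_one[OF u x])
    have "Y (X x) = sv_op k v (\<lambda>_. 1) v x"
      using X x d by (simp add: Y_def sv_op_compose[OF u] cong: sv_op_cong)
    then show "Y (X x) = x"
      by (simp only: sv_op_one[OF v x])
  qed
  then show ?thesis
    unfolding invertible_on_def using sv_op_bounded_op[OF v u] Y_def by blast
qed

section \<open>Compressions along an asymptotically commuting filtration\<close>

locale asymptotically_commuting_filtration =
  fixes T :: "'a::chilbert_space \<Rightarrow> 'a" and P :: "nat \<Rightarrow> 'a \<Rightarrow> 'a"
  assumes T: "bounded_op_on UNIV T" and P: "filtration P"
    and comm: "(\<lambda>n. onorm (commutator (P n) T)) \<longlonglongrightarrow> 0"
begin

abbreviation "M n \<equiv> range (P n)"
abbreviation "S n \<equiv> compression (P n) T"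
abbreviation "\<delta> n \<equiv> onorm (commutator (P n) T)"

lemma T_lin: "bounded_linear T" and T_scale: "T (c *\<^sub>C x) = c *\<^sub>C T x"
  using T by (simp_all add: bounded_op_on_UNIV)

sublocale T: bounded_linear T
  by (rule T_lin)

lemma P_lin: "bounded_linear (P n)" and P_scale: "P n (c *\<^sub>C x) = c *\<^sub>C P n x"
  and P_idem [simp]: "P n (P n x) = P n x"
  using P by (simp_all add: filtration_def finite_rank_projection_def bounded_op_on_UNIV)

lemma P_inner: "P n x \<bullet> y = x \<bullet> P n y"
  using P unfolding filtration_def finite_rank_projection_def is_adjoint_on_def Re_cinner[symmetric]
  by simp

lemma P_fix: "x \<in> M n \<Longrightarrow> P n x = x"
  by auto

lemma norm_P_le: "norm (P n x) \<le> norm x"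
proof -
  have "norm (P n x) * norm (P n x) = P n x \<bullet> x"
    using P_inner[of n "P n x" x] by (simp add: dot_square_norm power2_eq_square)
  also have "\<dots> \<le> norm (P n x) * norm x"
    by (rule norm_cauchy_schwarz)
  finally show ?thesis
    by (cases "norm (P n x) = 0") (simp_all add: mult_le_cancel_left)
qed

lemma P_tendsto: "(\<lambda>n. P n x) \<longlonglongrightarrow> x"
  using P by (simp add: filtration_def LIM_zero_iff tendsto_norm_zero_iff)

lemma M_onb: "\<exists>k e. orthonormal_basis_on (M n) k e"
proof -
  obtain B where "finite B" "M n = cspan B"
    using P unfolding filtration_def finite_rank_projection_def by blast
  then show ?thesis
    using onb_exists by simp
qed

lemma S_bounded: "bounded_op_on UNIV (S n)"
proof -
  have "bounded_linear (\<lambda>x. P n (T (P n x)))"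
    by (intro bounded_linear_compose[OF P_lin] bounded_linear_compose[OF T_lin] P_lin)
  then show ?thesis
    by (simp add: bounded_op_on_UNIV compression_def[abs_def] P_scale T_scale)
qed

lemma S_mem: "S n x \<in> M n"
  by (simp add: compression_def)

lemma S_bounded_on: "bounded_op_on (M n) (S n)"
proof -
  obtain K where "\<And>x. norm (S n x) \<le> norm x * K"
    using bounded_op_on_bound[OF S_bounded] by blast
  then show ?thesis
    using S_bounded[of n] S_mem[of n] unfolding bounded_op_on_def by blast
qed

lemma norm_S_le: "norm (S n x) \<le> onorm T * norm x"
  unfolding compression_def
  using onorm[OF T_lin, of "P n x"] norm_P_le[of n "T (P n x)"] norm_P_le[of n x]
    mult_left_mono[OF norm_P_le[of n x] onorm_pos_le[OF T_lin]] by linarith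

lemma commutator_lin: "bounded_linear (commutator (P n) T)"
  by (intro bounded_linear_sub bounded_linear_compose[OF P_lin T_lin] bounded_linear_compose[OF T_lin P_lin])

lemma commutator_le: "norm (P n (T x) - T (P n x)) \<le> \<delta> n * norm x"
  by (rule onorm[OF commutator_lin])

lemma \<delta>_nonneg: "0 \<le> \<delta> n"
  by (rule onorm_pos_le[OF commutator_lin])

lemma S_close: "x \<in> M n \<Longrightarrow> norm (S n x - T x) \<le> \<delta> n * norm x"
  using commutator_le[of n x] by (simp only: compression_def P_fix)

lemma S_tendsto: "(\<lambda>n. S n (P n x)) \<longlonglongrightarrow> T x"
proof -
  have "(\<lambda>n. S n (P n x) - T (P n x)) \<longlonglongrightarrow> 0"
  proof (rule Lim_null_comparison)
    show "\<forall>\<^sub>F n in sequentially. norm (S n (P n x) - T (P n x)) \<le> \<delta> n * norm x"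
    proof (intro always_eventually allI)
      fix n
      have "norm (S n (P n x) - T (P n x)) \<le> \<delta> n * norm (P n x)"
        by (intro S_close) simp
      also have "\<dots> \<le> \<delta> n * norm x"
        by (intro mult_left_mono norm_P_le \<delta>_nonneg)
      finally show "norm (S n (P n x) - T (P n x)) \<le> \<delta> n * norm x" .
    qed
    show "(\<lambda>n. \<delta> n * norm x) \<longlonglongrightarrow> 0"
      using tendsto_mult_left_zero[OF comm] .
  qed
  then have "(\<lambda>n. (S n (P n x) - T (P n x)) + T (P n x)) \<longlonglongrightarrow> 0 + T x"
    by (intro tendsto_add T.tendsto P_tendsto)
  then show ?thesis by simp
qed

lemma op_norm_S_le: "op_norm_on (M n) (S n) \<le> onorm T"
  by (rule op_norm_on_le) (simp_all add: norm_S_le onorm_pos_le[OF T_lin])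

text \<open>Compressing never increases the norm, and strong convergence at one vector that nearly
  attains \<open>onorm T\<close> gives the bound from below.\<close>

lemma op_norm_S_tendsto: "(\<lambda>n. op_norm_on (M n) (S n)) \<longlonglongrightarrow> onorm T"
proof (rule order_tendstoI)
  fix a assume "onorm T < a"
  then show "\<forall>\<^sub>F n in sequentially. op_norm_on (M n) (S n) < a"
    by (intro always_eventually allI le_less_trans[OF op_norm_S_le])
next
  fix a assume a: "a < onorm T"
  show "\<forall>\<^sub>F n in sequentially. a < op_norm_on (M n) (S n)"
  proof (cases "a < 0")
    case True
    then show ?thesis
      by (intro always_eventually allI less_le_trans[OF _ op_norm_on_nonneg[OF S_bounded_on]]) auto
  next
    case False
    have "\<not> (\<forall>x. norm (T x) \<le> a * norm x)"
      using onorm_bound[of a T] a False by auto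
    then obtain x where x: "a * norm x < norm (T x)"
      by (auto simp: not_le)
    have "(\<lambda>n. norm (S n (P n x))) \<longlonglongrightarrow> norm (T x)"
      by (intro tendsto_norm S_tendsto)
    then have "\<forall>\<^sub>F n in sequentially. a * norm x < norm (S n (P n x))"
      using x by (rule order_tendstoD)
    then show ?thesis
    proof (rule eventually_mono)
      fix n assume "a * norm x < norm (S n (P n x))"
      also have "\<dots> \<le> op_norm_on (M n) (S n) * norm (P n x)"
        by (rule le_op_norm_on[OF S_bounded_on]) simp
      also have "\<dots> \<le> op_norm_on (M n) (S n) * norm x"
        by (intro mult_left_mono norm_P_le op_norm_on_nonneg S_bounded_on) simp
      finally show "a < op_norm_on (M n) (S n)"
        by (rule mult_right_less_imp_less) simp
    qed
  qed
qed

section \<open>Norms of inverses\<close>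

lemma inv_norm_S_le_iff:
  assumes "0 \<le> K"
  shows "inv_norm_on (M n) (S n) \<le> ereal K \<longleftrightarrow> (\<forall>x\<in>M n. norm x \<le> K * norm (S n x))"
proof -
  obtain k e where e: "orthonormal_basis_on (M n) k e"
    using M_onb by blast
  have "invertible_on (M n) (S n)" if "\<forall>x\<in>M n. norm x \<le> K * norm (S n x)"
    using that S_mem by (intro invertible_on_finite_dim[OF S_bounded e]) auto
  then show ?thesis
    using inv_norm_on_le_iff[OF S_bounded_on _ assms, of n] by auto
qed

text \<open>Surjectivity: the least squares solution \<open>x\<close> of \<open>T x = y\<close> is at least as good as the
  approximate solutions \<open>(S n)\<inverse> (P n y)\<close>, along which \<open>T\<close> converges to \<open>y\<close>.\<close>

lemma inv_norm_T_le_of_frequently: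
  assumes K: "0 \<le> K" and freq: "\<exists>\<^sub>F n in sequentially. inv_norm_on (M n) (S n) \<le> ereal K"
  shows "inv_norm_on UNIV T \<le> ereal K"
proof -
  \<comment> \<open>A violation at \<open>x\<close> is a strict inequality between limits, hence
    persists at \<open>P n x\<close> for all large \<open>n\<close>.\<close>
  have lower: "norm x \<le> K * norm (T x)" for x
  proof (rule ccontr)
    assume "\<not> norm x \<le> K * norm (T x)"
    then have "0 < norm x - K * norm (T x)"
      by simp
    moreover have "(\<lambda>n. norm (P n x) - K * norm (S n (P n x))) \<longlonglongrightarrow> norm x - K * norm (T x)"
      by (intro tendsto_intros P_tendsto S_tendsto)
    ultimately have "\<forall>\<^sub>F n in sequentially. 0 < norm (P n x) - K * norm (S n (P n x))"
      by (rule order_tendstoD(1)[rotated])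
    then have "\<forall>\<^sub>F n in sequentially. \<not> inv_norm_on (M n) (S n) \<le> ereal K"
      by (rule eventually_mono) (metis inv_norm_S_le_iff[OF K] rangeI diff_gt_0_iff_gt not_less)
    then show False
      using freq by (simp add: frequently_def)
  qed
  have surj: "\<exists>x. T x = y" for y
  proof -
    have "bounded_linear (\<lambda>z. y \<bullet> T z)"
      by (rule bounded_linear_compose[OF bounded_linear_inner_right T_lin])
    then obtain x where x: "\<And>z. T x \<bullet> T z = y \<bullet> T z"
      using lax_milgram[OF subspace_UNIV closed_UNIV T_lin _ lower] by blast
    \<comment> \<open>By the normal equations \<open>T x - y\<close> is orthogonal to the range of
      \<open>T\<close>.\<close>
    have best: "norm (T x - y) \<le> norm (T z - y)" for z
    proof -
      have "norm (T x - y) * norm (T x - y) = (T x - y) \<bullet> (T z - y)"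
        using x[of x] x[of z]
        by (simp add: inner_diff_left inner_diff_right flip: power2_eq_square dot_square_norm)
      also have "\<dots> \<le> norm (T x - y) * norm (T z - y)"
        by (rule norm_cauchy_schwarz)
      finally show ?thesis
        by (cases "norm (T x - y) = 0") (simp_all add: mult_le_cancel_left)
    qed
    have "T x = y"
    proof (rule ccontr)
      assume "T x \<noteq> y"
      then have pos: "0 < norm (T x - y)"
        by simp
      \<comment> \<open>This bounds the residual of the approximate solution: projecting
        \<open>y\<close> costs the first term, replacing \<open>S n\<close> by \<open>T\<close> the
        second, as that solution has norm at most \<open>K * norm y\<close>.\<close>
      have "(\<lambda>n. norm (P n y - y) + \<delta> n * (K * norm y)) \<longlonglongrightarrow> norm (y - y) + 0 * (K * norm y)"
        by (intro tendsto_intros P_tendsto comm)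
      then have "\<forall>\<^sub>F n in sequentially. norm (P n y - y) + \<delta> n * (K * norm y) < norm (T x - y)"
        using pos by (intro order_tendstoD) auto
      then have "\<forall>\<^sub>F n in sequentially. \<not> inv_norm_on (M n) (S n) \<le> ereal K"
      proof (rule eventually_mono, intro notI)
        fix n
        assume small: "norm (P n y - y) + \<delta> n * (K * norm y) < norm (T x - y)"
          and le: "inv_norm_on (M n) (S n) \<le> ereal K"
        have "invertible_on (M n) (S n)" and Sle: "\<forall>x\<in>M n. norm x \<le> K * norm (S n x)"
          using inv_norm_on_le_iff[OF S_bounded_on _ K, of n] le by auto
        then obtain Y where "bounded_op_on (M n) Y" "\<forall>x\<in>M n. S n (Y x) = x"
          unfolding invertible_on_def by blast
        then obtain z where z: "z \<in> M n" "S n z = P n y"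
          unfolding bounded_op_on_def by blast
        have "norm z \<le> K * norm y"
          using Sle z norm_P_le[of n y] K by (metis mult_left_mono order_trans)
        then have "norm (S n z - T z) \<le> \<delta> n * (K * norm y)"
          using S_close[OF z(1)] \<delta>_nonneg[of n] by (meson mult_left_mono order_trans)
        moreover have "norm (T z - y) \<le> norm (T z - S n z) + norm (S n z - y)"
          using norm_triangle_ineq[of "T z - S n z" "S n z - y"] by simp
        ultimately show False
          using small best[of z] z(2) by (simp add: norm_minus_commute)
      qed
      then show False
        using freq by (simp add: frequently_def)
    qed
    then show ?thesis ..
  qed
  define Y where "Y = inv T"
  have inj: "inj T"
  proof (rule injI)
    fix x y assume "T x = T y"
    then show "x = y"
      using lower[of "x - y"] by (simp add: T.diff)
  qed
  have TY: "T (Y y) = y" for y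
    unfolding Y_def using surj by (metis surjI surj_f_inv_f)
  have YT: "Y (T x) = x" for x
    unfolding Y_def using inj by (rule inv_f_f)
  have "bounded_op_on UNIV Y"
    unfolding bounded_op_on_def
  proof (intro conjI ballI allI exI)
    show "Y (x + y) = Y x + Y y" for x y
      by (metis T.add TY YT)
    show "Y (c *\<^sub>C x) = c *\<^sub>C Y x" for c x
      by (metis T_scale TY YT)
    show "norm (Y x) \<le> norm x * K" for x
      using lower[of "Y x"] by (simp add: TY mult.commute)
  qed simp
  then have "invertible_on UNIV T"
    unfolding invertible_on_def using TY YT by blast
  then show ?thesis
    using inv_norm_on_le_iff[OF T _ K] lower by simp
qed

text \<open>From below: a finite bound holding for infinitely many compressions would pass to
  \<open>T\<close>, which also settles the case where the limit is \<open>\<infinity>\<close>. From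
  above: a lower bound for \<open>T\<close> survives a perturbation by \<open>\<delta> n\<close>
  with a slightly larger constant.\<close>

lemma inv_norm_S_tendsto: "(\<lambda>n. inv_norm_on (M n) (S n)) \<longlonglongrightarrow> inv_norm_on UNIV T"
proof (rule order_tendstoI)
  fix a assume a: "a < inv_norm_on UNIV T"
  show "\<forall>\<^sub>F n in sequentially. a < inv_norm_on (M n) (S n)"
  proof (rule ccontr)
    assume "\<not> ?thesis"
    then have freq: "\<exists>\<^sub>F n in sequentially. inv_norm_on (M n) (S n) \<le> a"
      by (simp add: not_eventually not_less)
    then obtain n where "inv_norm_on (M n) (S n) \<le> a"
      using frequently_ex by blast
    then have "0 \<le> a"
      using inv_norm_on_nonneg[of "M n" "S n"] by auto
    then obtain K where "a = ereal K" "0 \<le> K"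
      using a by (cases a) auto
    then have "inv_norm_on UNIV T \<le> a"
      using inv_norm_T_le_of_frequently[of K] freq by simp
    then show False
      using a by simp
  qed
next
  fix a assume a: "inv_norm_on UNIV T < a"
  then obtain K where K: "inv_norm_on UNIV T < ereal K" "ereal K < a"
    using ereal_dense2 by blast
  have "0 \<le> inv_norm_on UNIV T"
    by (rule inv_norm_on_nonneg) simp
  then obtain c where c: "inv_norm_on UNIV T = ereal c" "0 \<le> c" "c < K"
    using K(1) by (cases "inv_norm_on UNIV T") auto
  then have lower: "norm x \<le> c * norm (T x)" for x
    using inv_norm_on_le_iff[OF T, of c] by simp
  \<comment> \<open>Absorbing the error turns the constant \<open>c\<close> into
    \<open>c / (1 - c * \<delta> n)\<close>; that this is below \<open>K\<close> reads
    \<open>c + c * \<delta> n * K < K\<close> without division.\<close>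
  have "(\<lambda>n. c + c * \<delta> n * K) \<longlonglongrightarrow> c + c * 0 * K"
    by (intro tendsto_intros comm)
  then have "\<forall>\<^sub>F n in sequentially. c + c * \<delta> n * K < K"
    using c(3) by (intro order_tendstoD) auto
  then show "\<forall>\<^sub>F n in sequentially. inv_norm_on (M n) (S n) < a"
  proof (rule eventually_mono)
    fix n assume n: "c + c * \<delta> n * K < K"
    have "norm x \<le> K * norm (S n x)" if x: "x \<in> M n" for x
    proof -
      have "norm (T x) \<le> norm (S n x) + \<delta> n * norm x"
        using norm_triangle_sub[of "T x" "S n x"] S_close[OF x] by (simp add: norm_minus_commute)
      then have "norm x \<le> c * (norm (S n x) + \<delta> n * norm x)"
        using lower[of x] c(2) by (meson mult_left_mono order_trans)
      then have "K * norm x \<le> K * (c * (norm (S n x) + \<delta> n * norm x))"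
        using c(2,3) by (intro mult_left_mono) auto
      then have "K * norm x \<le> K * c * norm (S n x) + (c * \<delta> n * K) * norm x"
        by (simp add: algebra_simps)
      moreover have "(c * \<delta> n * K) * norm x \<le> (K - c) * norm x"
        using n by (intro mult_right_mono) auto
      ultimately have "c * norm x \<le> c * (K * norm (S n x))"
        by (simp add: algebra_simps)
      \<comment> \<open>\<open>c = 0\<close> forces \<open>x = 0\<close>; otherwise \<open>c\<close>
        is cancelled.\<close>
      then show ?thesis
        using c(2,3) lower[of x] by (cases "c = 0") (simp_all add: mult_le_cancel_left)
    qed
    then have "inv_norm_on (M n) (S n) \<le> ereal K"
      using c by (simp add: inv_norm_S_le_iff)
    then show "inv_norm_on (M n) (S n) < a"
      using K(2) by simp
  qed
qed

lemma cond_S_tendsto: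
  assumes "invertible_on UNIV T"
  shows "(\<lambda>n. cond_on (M n) (S n)) \<longlonglongrightarrow> cond_on UNIV T"
proof -
  have fin: "\<bar>inv_norm_on UNIV T\<bar> \<noteq> \<infinity>"
    using assms by (simp add: inv_norm_on_def)
  have "(\<lambda>n. ereal (op_norm_on (M n) (S n)) * inv_norm_on (M n) (S n)) \<longlonglongrightarrow>
      ereal (onorm T) * inv_norm_on UNIV T"
    using fin by (intro tendsto_mult_ereal tendsto_ereal op_norm_S_tendsto inv_norm_S_tendsto) auto
  \<comment> \<open>A finite limit makes the compressions eventually invertible, so the stipulated
    value \<open>\<infinity>\<close> of \<open>cond_on\<close> is confined to finitely many
    \<open>n\<close>.\<close>
  moreover have "\<forall>\<^sub>F n in sequentially. inv_norm_on (M n) (S n) < \<infinity>"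
    using fin by (intro order_tendstoD[OF inv_norm_S_tendsto]) auto
  then have "\<forall>\<^sub>F n in sequentially.
      ereal (op_norm_on (M n) (S n)) * inv_norm_on (M n) (S n) = cond_on (M n) (S n)"
    by (rule eventually_mono) (auto simp: cond_on_def inv_norm_on_def split: if_splits)
  ultimately have "(\<lambda>n. cond_on (M n) (S n)) \<longlonglongrightarrow> ereal (onorm T) * inv_norm_on UNIV T"
    by (rule Lim_transform_eventually)
  then show ?thesis
    using assms by (simp add: cond_on_def op_norm_on_UNIV)
qed

end

section \<open>Generalized condition numbers\<close>

lemma is_adjoint_on_cadjoint:
  assumes T: "bounded_op_on UNIV T"
  shows "is_adjoint_on UNIV T (cadjoint T)"
proof -
  have "bounded_linear T" and scale: "\<And>c x. T (c *\<^sub>C x) = c *\<^sub>C T x"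
    using T by (simp_all add: bounded_op_on_UNIV)
  then obtain C where "\<And>x y. T x \<bullet> y = x \<bullet> C y"
    using real_adjoint_ex by blast
  then have "is_adjoint_on UNIV T C"
    by (intro is_adjoint_on_UNIV_of_inner scale)
  then show ?thesis
    unfolding cadjoint_def
  proof (rule theI[of "is_adjoint_on UNIV T"])
    fix C' assume C': "is_adjoint_on UNIV T C'"
    show "C' = C"
    proof
      fix y
      have "cinner x (C' y - C y) = 0" for x
        using C'[unfolded is_adjoint_on_def, rule_format, of x y]
          \<open>is_adjoint_on UNIV T C\<close>[unfolded is_adjoint_on_def, rule_format, of x y]
        by (simp add: cinner_diff_right)
      then have "cinner (C' y - C y) (C' y - C y) = 0" .
      then show "C' y = C y"
        by (simp add: cinner_self)
    qed
  qed
qed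

lemma cadjoint_inner: "bounded_op_on UNIV T \<Longrightarrow> T x \<bullet> y = x \<bullet> cadjoint T y"
  using is_adjoint_on_cadjoint[of T] unfolding is_adjoint_on_def Re_cinner[symmetric] by simp

lemma is_mp_inverse_on_cong:
  assumes "\<And>x. x \<in> M \<Longrightarrow> X x = X' x" "\<And>x. x \<in> M \<Longrightarrow> X' x \<in> M" "is_mp_inverse_on M X' Y"
  shows "is_mp_inverse_on M X Y"
proof -
  have "Y x \<in> M" if "x \<in> M" for x
    using assms(3) that by (auto simp: is_mp_inverse_on_def bounded_op_on_def)
  then show ?thesis
    using assms unfolding is_mp_inverse_on_def is_adjoint_on_def by simp
qed

text \<open>\<open>mp_inverse_on\<close> is a choice; uniqueness on \<open>M\<close> identifies it
  there with the reciprocal singular values.\<close>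

lemma op_norm_mp_inverse_sv_op:
  assumes u: "orthonormal_basis_on M k u" and v: "orthonormal_basis_on M k v"
    and R: "\<And>x. x \<in> M \<Longrightarrow> R x = sv_op k u d v x"
  shows "op_norm_on M (mp_inverse_on M R) = op_norm_on M (sv_op k v (\<lambda>j. inverse (d j)) u)"
proof (rule op_norm_on_cong)
  fix x assume x: "x \<in> M"
  have Y: "is_mp_inverse_on M R (sv_op k v (\<lambda>j. inverse (d j)) u)"
    using R sv_op_mem[OF u] sv_op_mp_inverse[OF u v] by (rule is_mp_inverse_on_cong)
  then have "is_mp_inverse_on M R (mp_inverse_on M R)"
    unfolding mp_inverse_on_def by (rule someI[of "is_mp_inverse_on M R"])
  moreover have "bounded_op_on M R"
    using sv_op_bounded_op[OF u v, of d] complex_vector.subspace_add[OF onb_subspace[OF u]]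
      complex_vector.subspace_scale[OF onb_subspace[OF u]] R
    unfolding bounded_op_on_def by (simp add: image_subset_iff)
  ultimately show "mp_inverse_on M R x = sv_op k v (\<lambda>j. inverse (d j)) u x"
    using Y x complex_vector.subspace_diff[OF onb_subspace[OF u]]
    by (intro is_mp_inverse_on_unique[of M R])
qed

section \<open>Regularized compressions\<close>

context asymptotically_commuting_filtration
begin

text \<open>The last clause is the weak form of \<open>S* u = s v\<close> for the adjoint on
  \<open>M n\<close>. In terms of the real inner product it can be tested directly against
  commutators.\<close>

definition singular_triple :: "nat \<Rightarrow> 'a \<Rightarrow> real \<Rightarrow> 'a \<Rightarrow> bool"
  where "singular_triple n u s v \<longleftrightarrow> u \<in> M n \<and> v \<in> M n \<and> norm u = 1 \<and> norm v = 1 \<and> 0 \<le> s \<and>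
    S n v = s *\<^sub>R u \<and> (\<forall>x\<in>M n. u \<bullet> S n x = s * (v \<bullet> x))"

context
  fixes \<epsilon> :: real and n :: nat
  assumes \<epsilon>: "0 < \<epsilon>"
begin

abbreviation "R \<equiv> regularization_on (M n) \<epsilon> (S n)"

lemma singular_data:
  obtains k u v d where "orthonormal_basis_on (M n) k u" "orthonormal_basis_on (M n) k v"
    "\<forall>j<k. 0 \<le> d j" "\<And>x. x \<in> M n \<Longrightarrow> S n x = sv_op k u d v x"
    "\<And>x. x \<in> M n \<Longrightarrow> R x = sv_op k u (\<lambda>j. if d j \<le> \<epsilon> then 0 else d j) v x"
    "\<forall>j<k. singular_triple n (u j) (d j) (v j)"
proof -
  obtain m e where e: "orthonormal_basis_on (M n) m e"
    using M_onb by blast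
  have "S n ` M n \<subseteq> M n"
    using S_mem by blast
  from regularization_sv_op[OF S_bounded e this, of \<epsilon>]
  obtain k u v d where u: "orthonormal_basis_on (M n) k u" and v: "orthonormal_basis_on (M n) k v"
    and d: "\<forall>j<k. 0 \<le> d j" and SR: "\<forall>x\<in>M n. S n x = sv_op k u d v x"
      "\<forall>x\<in>M n. R x = sv_op k u (\<lambda>j. if d j \<le> \<epsilon> then 0 else d j) v x"
    by (elim exE conjE) (rule that)
  note S = SR(1)[rule_format] and R = SR(2)[rule_format]
  have "singular_triple n (u j) (d j) (v j)" if j: "j < k" for j
    unfolding singular_triple_def
  proof (intro conjI ballI)
    show "S n (v j) = d j *\<^sub>R u j"
      using S[OF onb_mem[OF v j]] by (simp add: sv_op_right_basis[OF v j] scaleC_of_real)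
    show "u j \<bullet> S n x = d j * (v j \<bullet> x)" if "x \<in> M n" for x
      unfolding Re_cinner[symmetric] S[OF that] by (simp add: sv_op_coeff[OF u j])
  qed (use j d onb_mem[OF u j] onb_mem[OF v j] onb_norm[OF u j] onb_norm[OF v j] in auto)
  then show thesis
    using that[OF u v d S R] by blast
qed

lemma op_norm_R_le: "op_norm_on (M n) R \<le> op_norm_on (M n) (S n)"
proof -
  obtain k u v d where u: "orthonormal_basis_on (M n) k u" and v: "orthonormal_basis_on (M n) k v"
    and d: "\<forall>j<k. 0 \<le> d j" and S: "\<And>x. x \<in> M n \<Longrightarrow> S n x = sv_op k u d v x"
    and R: "\<And>x. x \<in> M n \<Longrightarrow> R x = sv_op k u (\<lambda>j. if d j \<le> \<epsilon> then 0 else d j) v x"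
    by (rule singular_data) (rule that)
  have S': "op_norm_on (M n) (S n) = op_norm_on (M n) (sv_op k u d v)"
    using S by (intro op_norm_on_cong) simp
  have nonneg: "0 \<le> op_norm_on (M n) (S n)"
    by (intro op_norm_on_nonneg S_bounded_on) simp
  have "op_norm_on (M n) R = op_norm_on (M n) (sv_op k u (\<lambda>j. if d j \<le> \<epsilon> then 0 else d j) v)"
    using R by (intro op_norm_on_cong) simp
  also have "\<dots> \<le> op_norm_on (M n) (S n)"
    using le_op_norm_sv_op[OF u v, of _ d] nonneg by (intro op_norm_sv_op_le[OF u v]) (auto simp: S')
  finally show ?thesis .
qed

lemma op_norm_R_nonneg: "0 \<le> op_norm_on (M n) R"
  and op_norm_R_mp_nonneg: "0 \<le> op_norm_on (M n) (mp_inverse_on (M n) R)"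
proof -
  obtain k u v d where u: "orthonormal_basis_on (M n) k u" and v: "orthonormal_basis_on (M n) k v"
    and R: "\<And>x. x \<in> M n \<Longrightarrow> R x = sv_op k u (\<lambda>j. if d j \<le> \<epsilon> then 0 else d j) v x"
    by (rule singular_data) (rule that)
  have "op_norm_on (M n) R = op_norm_on (M n) (sv_op k u (\<lambda>j. if d j \<le> \<epsilon> then 0 else d j) v)"
    using R by (intro op_norm_on_cong) simp
  then show "0 \<le> op_norm_on (M n) R"
    using op_norm_on_nonneg[OF sv_op_bounded_op[OF u v]] by simp
  show "0 \<le> op_norm_on (M n) (mp_inverse_on (M n) R)"
    using op_norm_mp_inverse_sv_op[OF u v, of R] R op_norm_on_nonneg[OF sv_op_bounded_op[OF v u]]
    by simp
qed

text \<open>The largest singular value lies above the threshold and survives. Bounding each value by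
  the maximum of \<open>\<epsilon>\<close> and the norm of \<open>R\<close> says so without singling
  it out.\<close>

lemma op_norm_R_eq:
  assumes "\<epsilon> < op_norm_on (M n) (S n)"
  shows "op_norm_on (M n) R = op_norm_on (M n) (S n)"
proof (rule antisym[OF op_norm_R_le])
  obtain k u v d where u: "orthonormal_basis_on (M n) k u" and v: "orthonormal_basis_on (M n) k v"
    and d: "\<forall>j<k. 0 \<le> d j" and S: "\<And>x. x \<in> M n \<Longrightarrow> S n x = sv_op k u d v x"
    and R: "\<And>x. x \<in> M n \<Longrightarrow> R x = sv_op k u (\<lambda>j. if d j \<le> \<epsilon> then 0 else d j) v x"
    by (rule singular_data) (rule that)
  have R': "op_norm_on (M n) R = op_norm_on (M n) (sv_op k u (\<lambda>j. if d j \<le> \<epsilon> then 0 else d j) v)"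
    using R by (intro op_norm_on_cong) simp
  have "op_norm_on (M n) (S n) = op_norm_on (M n) (sv_op k u d v)"
    using S by (intro op_norm_on_cong) simp
  also have "\<dots> \<le> max \<epsilon> (op_norm_on (M n) R)"
  proof (rule op_norm_sv_op_le[OF u v])
    fix j assume j: "j < k"
    show "\<bar>d j\<bar> \<le> max \<epsilon> (op_norm_on (M n) R)"
      using le_op_norm_sv_op[OF u v j, of "\<lambda>j. if d j \<le> \<epsilon> then 0 else d j"] d j
      by (auto simp: R' split: if_splits)
  qed (use \<epsilon> in simp)
  finally show "op_norm_on (M n) (S n) \<le> op_norm_on (M n) R"
    using assms by linarith
qed

lemma op_norm_R_mp_le:
  assumes gap: "\<And>u s v. singular_triple n u s v \<Longrightarrow> s \<le> \<epsilon> \<or> \<gamma> < s" and \<gamma>: "0 < \<gamma>"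
  shows "op_norm_on (M n) (mp_inverse_on (M n) R) \<le> 1 / \<gamma>"
proof -
  obtain k u v d where u: "orthonormal_basis_on (M n) k u" and v: "orthonormal_basis_on (M n) k v"
    and d: "\<forall>j<k. 0 \<le> d j"
    and R: "\<And>x. x \<in> M n \<Longrightarrow> R x = sv_op k u (\<lambda>j. if d j \<le> \<epsilon> then 0 else d j) v x"
    and st: "\<forall>j<k. singular_triple n (u j) (d j) (v j)"
    by (rule singular_data) (rule that)
  have "op_norm_on (M n) (mp_inverse_on (M n) R) =
      op_norm_on (M n) (sv_op k v (\<lambda>j. inverse (if d j \<le> \<epsilon> then 0 else d j)) u)"
    using R by (intro op_norm_mp_inverse_sv_op[OF u v]) simp
  also have "\<dots> \<le> 1 / \<gamma>"
  proof (rule op_norm_sv_op_le[OF v u])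
    fix j assume j: "j < k"
    show "\<bar>inverse (if d j \<le> \<epsilon> then 0 else d j)\<bar> \<le> 1 / \<gamma>"
    proof (cases "d j \<le> \<epsilon>")
      case False
      then have "\<gamma> < d j"
        using gap st j by blast
      then show ?thesis
        using False \<gamma> by (simp add: inverse_eq_divide frac_le)
    qed (use \<gamma> in simp)
  qed (use \<gamma> in simp)
  finally show ?thesis .
qed

end

end

section \<open>Closed range operators and the gap in the singular values\<close>

locale closed_range_filtration = asymptotically_commuting_filtration +
  assumes closed_range: "closed (range T)" and nonzero: "T \<noteq> (\<lambda>x. 0)"
begin

definition "Y = mp_inverse_on UNIV T"

text \<open>The orthogonal projection onto the orthogonal complement of the kernel of
  \<open>T\<close>.\<close>

definition "Q x = Y (T x)"

text \<open>The reduced minimum modulus of \<open>T\<close>. For \<open>T = 0\<close> the quotient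
  would be \<open>1 / 0 = 0\<close> instead of infinity, whence the assumption
  \<open>nonzero\<close>.\<close>

definition "g = 1 / onorm Y"

lemma Y_mp: "is_mp_inverse_on UNIV T Y"
  unfolding Y_def mp_inverse_on_def using mp_inverse_ex[OF T closed_range] by (rule someI_ex)

lemma Y_lin: "bounded_linear Y" and TYT: "T (Y (T x)) = T x" and YTY: "Y (T (Y x)) = Y x"
  and TY_inner: "T (Y x) \<bullet> y = x \<bullet> T (Y y)" and Q_inner: "Q x \<bullet> y = x \<bullet> Q y"
  using Y_mp
  unfolding is_mp_inverse_on_def is_adjoint_on_def Q_def Re_cinner[symmetric] bounded_op_on_UNIV
  by simp_all

lemma Q_lin: "bounded_linear Q"
  unfolding Q_def[abs_def] by (rule bounded_linear_compose[OF Y_lin T_lin])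

lemma TQ: "T (Q x) = T x" and QQ: "Q (Q x) = Q x" and QY: "Q (Y x) = Y x"
  by (simp_all add: Q_def TYT YTY)

lemma Y_norm_pos: "0 < onorm Y"
proof -
  obtain x where "T x \<noteq> 0"
    using nonzero by blast
  then have "Y (T x) \<noteq> 0"
    using TYT[of x] T.zero by metis
  then show ?thesis
    using onorm_pos_lt[OF Y_lin] by blast
qed

lemma g_pos: "0 < g" and g_inverse: "onorm Y = 1 / g"
  using Y_norm_pos by (simp_all add: g_def)

lemma norm_Q_le: "g * norm (Q x) \<le> norm (T x)"
  using onorm[OF Y_lin, of "T x"] g_pos by (simp add: g_inverse Q_def field_simps)

lemma norm_TY_le: "norm (T (Y x)) \<le> norm x"
proof -
  have "norm (T (Y x)) * norm (T (Y x)) = x \<bullet> T (Y x)"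
    using TY_inner[of x "T (Y x)"] by (simp add: YTY dot_square_norm power2_eq_square)
  also have "\<dots> \<le> norm x * norm (T (Y x))"
    by (rule norm_cauchy_schwarz)
  finally show ?thesis
    by (cases "norm (T (Y x)) = 0") (simp_all add: mult_le_cancel_right)
qed

lemma T_norm_pos: "0 < onorm T"
  using nonzero onorm_pos_lt[OF T_lin] by blast

lemma g_le_onorm: "g \<le> onorm T"
proof -
  obtain x where "T x \<noteq> 0"
    using nonzero by blast
  then have "Q x \<noteq> 0"
    using TQ[of x] T.zero by metis
  have "g * norm (Q x) \<le> norm (T (Q x))"
    using norm_Q_le[of x] by (simp only: TQ)
  also have "\<dots> \<le> onorm T * norm (Q x)"
    by (rule onorm[OF T_lin])
  finally show ?thesis
    using \<open>Q x \<noteq> 0\<close> by simp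
qed

text \<open>On the range of \<open>Q\<close> the operator \<open>B = T* T - g\<^sup>2\<close> is nonnegative with \<open>\<parallel>B x\<parallel>\<^sup>2 \<le> \<parallel>T\<parallel>\<^sup>2 \<langle>x, B x\<rangle>\<close>, so
  if it were invertible, then \<open>\<parallel>T x\<parallel> \<ge> g' \<parallel>x\<parallel>\<close> would hold there for some \<open>g' > g\<close>.\<close>

lemma g_in_spectrum: "complex_of_real (g ^ 2) \<in> op_spectrum (\<lambda>x. cadjoint T (T x))"
proof (rule ccontr)
  assume "\<not> ?thesis"
  then obtain Z where Z: "bounded_op_on UNIV Z"
    and inv: "\<And>x. Z (complex_of_real (g ^ 2) *\<^sub>C x - cadjoint T (T x)) = x"
    by (auto simp: op_spectrum_def invertible_on_def)
  obtain K where K: "K > 0" "\<And>x. norm (Z x) \<le> norm x * K"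
    using Z bounded_linear.pos_bounded[of Z] by (auto simp: bounded_op_on_UNIV)
  define B where "B x = cadjoint T (T x) - (g\<^sup>2) *\<^sub>R x" for x
  define \<beta> where "\<beta> = (onorm T)\<^sup>2"
  have \<beta>: "\<beta> > 0"
    using T_norm_pos by (simp add: \<beta>_def)
  have B_inner: "B x \<bullet> y = T x \<bullet> T y - g\<^sup>2 * (x \<bullet> y)" for x y
    using cadjoint_inner[OF T, of y "T x"] by (simp add: B_def inner_diff_left inner_commute[of "T x" "T y"]
        inner_commute[of "cadjoint T (T x)" y])
  have sym: "B x \<bullet> y = B y \<bullet> x" for x y
    unfolding B_inner by (simp only: inner_commute)
  have lower: "norm x \<le> K * norm (B x)" for x
    using K(2)[of "complex_of_real (g ^ 2) *\<^sub>C x - cadjoint T (T x)", unfolded inv]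
    unfolding scaleC_of_real B_def by (simp add: norm_minus_commute mult.commute)
  \<comment> \<open>Invariance of the range of \<open>Q\<close> under \<open>B\<close> allows
    nonnegativity to be applied at \<open>x - t *\<^sub>R B x\<close> below.\<close>
  have QB: "Q (B x) = B x" if "Q x = x" for x
  proof -
    have "(Q (B x) - B x) \<bullet> y = 0" for y
    proof -
      have "x \<bullet> Q y = x \<bullet> y"
        using Q_inner[of x y] that by simp
      then show ?thesis
        by (simp add: inner_diff_left Q_inner B_inner TQ)
    qed
    then show ?thesis
      by (metis inner_eq_zero_iff right_minus_eq)
  qed
  have nonneg: "0 \<le> B x \<bullet> x" if "Q x = x" for x
  proof -
    have "(g * norm x)\<^sup>2 \<le> (norm (T x))\<^sup>2"
      using norm_Q_le[of x] that g_pos by (intro power_mono) auto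
    then show ?thesis
      by (simp add: B_inner dot_square_norm power_mult_distrib)
  qed
  have BB: "(norm (B x))\<^sup>2 \<le> \<beta> * (B x \<bullet> x)" if x: "Q x = x" for x
  proof -
    \<comment> \<open>This minimises \<open>t\<^sup>2 * \<beta> - 2 * t\<close>, the coefficient of
      the squared norm of \<open>B x\<close> in the final estimate.\<close>
    define t where "t = 1 / \<beta>"
    interpret Q: bounded_linear Q
      by (rule Q_lin)
    define z where "z = x - t *\<^sub>R B x"
    have "Q z = z"
      by (simp add: z_def Q.diff Q.scaleR x QB)
    then have "0 \<le> B z \<bullet> z"
      by (rule nonneg)
    also have "B z \<bullet> z = B z \<bullet> x - t * (B z \<bullet> B x)"
      by (subst (2) z_def) (simp add: inner_diff_right)
    also have "B z \<bullet> x = B x \<bullet> x - t * (B x \<bullet> B x)"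
      using sym[of z x] by (simp add: z_def inner_diff_right)
    also have "B z \<bullet> B x = B x \<bullet> B x - t * (B (B x) \<bullet> B x)"
      using sym[of z "B x"] sym[of "B x" x] by (simp add: z_def inner_diff_right)
    also have "B x \<bullet> x - t * (B x \<bullet> B x) - t * (B x \<bullet> B x - t * (B (B x) \<bullet> B x)) =
        B x \<bullet> x - 2 * t * (B x \<bullet> B x) + t\<^sup>2 * (B (B x) \<bullet> B x)"
      by (simp add: algebra_simps power2_eq_square)
    also have "B (B x) \<bullet> B x \<le> \<beta> * (norm (B x))\<^sup>2"
    proof -
      have "(norm (T (B x)))\<^sup>2 \<le> (onorm T * norm (B x))\<^sup>2"
        by (intro power_mono onorm[OF T_lin]) simp
      then show ?thesis
        by (simp add: B_inner dot_square_norm \<beta>_def power_mult_distrib)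
          (smt (verit) mult_nonneg_nonneg zero_le_power2)
    qed
    finally have "0 \<le> B x \<bullet> x - 2 * t * (B x \<bullet> B x) + t\<^sup>2 * (\<beta> * (norm (B x))\<^sup>2)"
      by (simp add: mult_left_mono)
    also have "\<dots> = B x \<bullet> x - (norm (B x))\<^sup>2 / \<beta>"
      using \<beta> by (simp add: t_def dot_square_norm field_simps power2_eq_square)
    finally show ?thesis
      using \<beta> by (simp add: field_simps)
  qed
  \<comment> \<open>Combines \<open>norm x \<le> K * norm (B x)\<close> with \<open>BB\<close>: on
    the range of \<open>Q\<close> the form of \<open>B\<close> is at least \<open>c\<close> times
    the squared norm.\<close>
  define c where "c = 1 / (K\<^sup>2 * \<beta>)"
  have c: "c > 0"
    using K(1) \<beta> by (simp add: c_def)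
  have gc: "(g\<^sup>2 + c) * (norm x)\<^sup>2 \<le> (norm (T x))\<^sup>2" if x: "Q x = x" for x
  proof -
    have "(norm x)\<^sup>2 \<le> (K * norm (B x))\<^sup>2"
      by (intro power_mono lower) simp
    also have "\<dots> \<le> K\<^sup>2 * (\<beta> * (B x \<bullet> x))"
      unfolding power_mult_distrib using BB[OF x] by (intro mult_left_mono) auto
    finally have "c * (norm x)\<^sup>2 \<le> B x \<bullet> x"
      using K(1) \<beta> by (simp add: c_def field_simps)
    then show ?thesis
      by (simp add: B_inner dot_square_norm algebra_simps)
  qed
  have "onorm Y \<le> 1 / sqrt (g\<^sup>2 + c)"
  proof (rule onorm_bound)
    fix x
    have "(g\<^sup>2 + c) * (norm (Y x))\<^sup>2 \<le> (norm (T (Y x)))\<^sup>2"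
      by (rule gc[OF QY])
    also have "\<dots> \<le> (norm x)\<^sup>2"
      by (intro power_mono norm_TY_le) simp
    finally have "(sqrt (g\<^sup>2 + c) * norm (Y x))\<^sup>2 \<le> (norm x)\<^sup>2"
      using c by (simp add: power_mult_distrib)
    then have "sqrt (g\<^sup>2 + c) * norm (Y x) \<le> norm x"
      by (rule power2_le_imp_le) simp
    moreover have "sqrt (g\<^sup>2 + c) > 0"
      using c by (simp add: add_nonneg_pos)
    ultimately show "norm (Y x) \<le> 1 / sqrt (g\<^sup>2 + c) * norm x"
      by (simp add: field_simps)
  qed (use c in simp)
  moreover have "g < sqrt (g\<^sup>2 + c)"
    using c by (intro real_less_rsqrt) simp
  then have "1 / sqrt (g\<^sup>2 + c) < 1 / g"
    using g_pos by (intro frac_less2) auto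
  ultimately show False
    unfolding g_inverse by linarith
qed

lemma less_g:
  assumes "ereal \<epsilon> < Inf {ereal l | l. 0 < l \<and> complex_of_real (l ^ 2) \<in> op_spectrum (\<lambda>x. cadjoint T (T x))}"
  shows "\<epsilon> < g"
proof -
  have "Inf {ereal l | l. 0 < l \<and> complex_of_real (l ^ 2) \<in> op_spectrum (\<lambda>x. cadjoint T (T x))} \<le> ereal g"
    using g_pos g_in_spectrum by (intro Inf_lower) blast
  with assms have "ereal \<epsilon> < ereal g"
    by (rule less_le_trans)
  then show ?thesis
    by simp
qed

text \<open>A singular vector \<open>v\<close> for \<open>s\<close> is an approximate eigenvector of \<open>T* T\<close> for \<open>s\<^sup>2\<close>. Testing with the
  components of \<open>v\<close> in the kernel of \<open>T\<close> and orthogonal to it shows that \<open>s\<close> is close to \<open>0\<close>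
  or not much smaller than \<open>g\<close>.\<close>

lemma singular_value_gap:
  assumes "singular_triple n u s v"
  shows "min (s\<^sup>2) (g\<^sup>2 - s\<^sup>2) \<le> 4 * onorm T * \<delta> n"
proof -
  have u: "u \<in> M n" "norm u = 1" and v: "v \<in> M n" "norm v = 1" and s: "0 \<le> s"
    and Sv: "S n v = s *\<^sub>R u" and uS: "\<And>x. x \<in> M n \<Longrightarrow> u \<bullet> S n x = s * (v \<bullet> x)"
    using assms by (auto simp: singular_triple_def)
  define D where "D = 2 * onorm T * \<delta> n"
  have D: "0 \<le> D"
    using T_norm_pos \<delta>_nonneg by (simp add: D_def)
  have s_le: "s \<le> onorm T"
    using norm_S_le[of n v] s u(2) v(2) by (simp add: Sv)
  \<comment> \<open>Replacing \<open>T v\<close> by \<open>S n v\<close>, and then moving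
    \<open>u\<close> across \<open>T\<close> by the singular relation, costs one commutator each;
    hence the factor 2 in \<open>D\<close>.\<close>
  have test: "\<bar>T v \<bullet> T z - s\<^sup>2 * (v \<bullet> z)\<bar> \<le> D * norm z" for z
  proof -
    have "u \<bullet> T z = u \<bullet> P n (T z)"
      using P_inner[of n u "T z"] P_fix[OF u(1)] by simp
    moreover have "u \<bullet> T (P n z) = s * (v \<bullet> z)"
    proof -
      have "u \<bullet> T (P n z) = u \<bullet> S n (P n z)"
        using P_inner[of n u "T (P n z)"] P_fix[OF u(1)] by (simp add: compression_def)
      also have "\<dots> = s * (P n v \<bullet> z)"
        using uS[of "P n z"] by (simp add: P_inner)
      finally show ?thesis
        using P_fix[OF v(1)] by simp
    qed
    ultimately have "u \<bullet> T z - s * (v \<bullet> z) = u \<bullet> (P n (T z) - T (P n z))"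
      by (simp add: inner_diff_right)
    also have "\<bar>\<dots>\<bar> \<le> \<delta> n * norm z"
      using Cauchy_Schwarz_ineq2[of u "P n (T z) - T (P n z)"] commutator_le[of n z] u(2) by simp
    finally have 1: "\<bar>s * (u \<bullet> T z - s * (v \<bullet> z))\<bar> \<le> onorm T * (\<delta> n * norm z)"
      unfolding abs_mult using s s_le \<delta>_nonneg[of n] by (intro mult_mono) auto
    have "\<bar>(T v - S n v) \<bullet> T z\<bar> \<le> norm (T v - S n v) * norm (T z)"
      by (rule Cauchy_Schwarz_ineq2)
    also have "\<dots> \<le> \<delta> n * (onorm T * norm z)"
      using S_close[OF v(1)] v(2) \<delta>_nonneg[of n] onorm[OF T_lin, of z]
      by (intro mult_mono) (simp_all add: norm_minus_commute)
    finally have 2: "\<bar>(T v - S n v) \<bullet> T z\<bar> \<le> onorm T * (\<delta> n * norm z)"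
      by (simp only: mult.left_commute)
    have "T v \<bullet> T z - s\<^sup>2 * (v \<bullet> z) = (T v - S n v) \<bullet> T z + s * (u \<bullet> T z - s * (v \<bullet> z))"
      by (simp add: inner_diff_left Sv algebra_simps power2_eq_square)
    then show ?thesis
      using 1 2 by (simp add: D_def mult.assoc)
  qed
  define a where "a = v - Q v"
  define b where "b = Q v"
  \<comment> \<open>Against \<open>a\<close> the test value is \<open>- s\<^sup>2\<close> times the
    squared norm, against \<open>b\<close> at least \<open>g\<^sup>2 - s\<^sup>2\<close> times it.
    So \<open>m * norm a\<close> and \<open>m * norm b\<close> are at most \<open>D\<close>, while
    the two norms sum to at least 1.\<close>
  define m where "m = min (s\<^sup>2) (g\<^sup>2 - s\<^sup>2)"
  have "m \<le> 2 * D"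
  proof (cases "m \<le> 0")
    case False
    have "v \<bullet> a = (norm a)\<^sup>2"
    proof -
      have "Q v \<bullet> a = 0"
        using Q_inner[of v "Q v"] Q_inner[of v v] by (simp add: a_def inner_diff_right QQ)
      then show ?thesis
        by (simp add: a_def inner_diff_left power2_norm_eq_inner)
    qed
    moreover have "T a = 0"
      by (simp add: a_def T.diff TQ)
    ultimately have "s\<^sup>2 * norm a * norm a \<le> D * norm a"
      using test[of a] by (simp add: power2_eq_square mult.assoc)
    then have "s\<^sup>2 * norm a \<le> D"
      using D by (cases "norm a = 0") (simp_all add: mult_le_cancel_right)
    moreover have "m * norm a \<le> s\<^sup>2 * norm a"
      by (intro mult_right_mono) (auto simp: m_def)
    ultimately have ma: "m * norm a \<le> D"
      by linarith
    have "v \<bullet> b = (norm b)\<^sup>2"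
      using Q_inner[of v "Q v"] by (simp add: b_def QQ power2_norm_eq_inner)
    moreover have "T v \<bullet> T b = (norm (T b))\<^sup>2"
      by (simp add: b_def TQ dot_square_norm)
    moreover have "(g * norm b)\<^sup>2 \<le> (norm (T b))\<^sup>2"
      using norm_Q_le[of v] g_pos by (intro power_mono) (auto simp: b_def TQ)
    ultimately have "(g\<^sup>2 - s\<^sup>2) * norm b * norm b \<le> D * norm b"
      using test[of b] by (simp add: power2_eq_square algebra_simps)
    then have "(g\<^sup>2 - s\<^sup>2) * norm b \<le> D"
      using D by (cases "norm b = 0") (simp_all add: mult_le_cancel_right)
    moreover have "m * norm b \<le> (g\<^sup>2 - s\<^sup>2) * norm b"
      by (intro mult_right_mono) (auto simp: m_def)
    ultimately have mb: "m * norm b \<le> D"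
      by linarith
    have "1 \<le> norm a + norm b"
      using norm_triangle_ineq[of a b] v(2) by (simp add: a_def b_def)
    then have "m * 1 \<le> m * (norm a + norm b)"
      using False by (intro mult_left_mono) auto
    then show ?thesis
      using ma mb by (simp add: distrib_left)
  qed (use D in simp)
  then show ?thesis
    by (simp add: m_def D_def)
qed

text \<open>Between the thresholds the minimum in \<open>singular_value_gap\<close> stays away from
  0. The pair is used as \<open>\<epsilon>\<close>, \<open>\<gamma>\<close> to bound the regularized
  inverses from above and as \<open>\<eta>\<close>, \<open>\<epsilon>\<close> to bound them from
  below.\<close>

lemma eventually_singular_value_gap:
  assumes "0 < \<eta>" "\<gamma> < g"
  shows "\<forall>\<^sub>F n in sequentially. \<forall>u s v. singular_triple n u s v \<longrightarrow> s < \<eta> \<or> \<gamma> < s"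
proof (cases "\<eta> \<le> \<gamma>")
  case True
  have "\<gamma>\<^sup>2 < g\<^sup>2"
    using assms True by (intro power_strict_mono) auto
  then have "0 < min (\<eta>\<^sup>2) (g\<^sup>2 - \<gamma>\<^sup>2)"
    using assms by simp
  moreover have "(\<lambda>n. 4 * onorm T * \<delta> n) \<longlonglongrightarrow> 4 * onorm T * 0"
    by (intro tendsto_intros comm)
  ultimately have "\<forall>\<^sub>F n in sequentially. 4 * onorm T * \<delta> n < min (\<eta>\<^sup>2) (g\<^sup>2 - \<gamma>\<^sup>2)"
    by (intro order_tendstoD) auto
  then show ?thesis
  proof (rule eventually_mono, intro allI impI)
    fix n u s v
    assume small: "4 * onorm T * \<delta> n < min (\<eta>\<^sup>2) (g\<^sup>2 - \<gamma>\<^sup>2)" and st: "singular_triple n u s v"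
    show "s < \<eta> \<or> \<gamma> < s"
    proof (rule ccontr)
      assume "\<not> ?thesis"
      then have "\<eta>\<^sup>2 \<le> s\<^sup>2" "s\<^sup>2 \<le> \<gamma>\<^sup>2"
        using assms(1) by (auto intro!: power_mono)
      then show False
        using small singular_value_gap[OF st] by linarith
    qed
  qed
qed (auto intro!: always_eventually)

text \<open>The component \<open>x''\<close> of \<open>P n b\<close> in the span of the right singular vectors belonging to singular
  values at most \<open>\<epsilon>\<close> is small, because \<open>b\<close> is orthogonal to the kernel of \<open>T\<close>. On the other component
  \<open>S n\<close> is bounded below by \<open>p\<close>.\<close>

lemma op_norm_R_mp_small:
  assumes \<epsilon>: "0 < \<epsilon>" and gap: "\<And>u s v. singular_triple n u s v \<Longrightarrow> s < \<eta> \<or> \<epsilon> < s" and \<eta>: "0 < \<eta>"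
    and p: "0 < p" and less: "op_norm_on (M n) (mp_inverse_on (M n) (R \<epsilon> n)) < 1 / p"
    and b: "Q b = b" "norm b = 1"
  shows "p\<^sup>2 * ((norm (P n b))\<^sup>2 - ((\<eta> + \<delta> n) / g)\<^sup>2) \<le> (norm (S n (P n b)))\<^sup>2"
proof -
  obtain k u v d where u: "orthonormal_basis_on (M n) k u" and v: "orthonormal_basis_on (M n) k v"
    and d: "\<forall>j<k. 0 \<le> d j" and S: "\<And>x. x \<in> M n \<Longrightarrow> S n x = sv_op k u d v x"
    and R: "\<And>x. x \<in> M n \<Longrightarrow> R \<epsilon> n x = sv_op k u (\<lambda>j. if d j \<le> \<epsilon> then 0 else d j) v x"
    and st: "\<forall>j<k. singular_triple n (u j) (d j) (v j)"
    by (rule singular_data[OF \<epsilon>]) (rule that)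
  \<comment> \<open>The indicator of the discarded singular values; with these coefficients
    \<open>sv_op k v \<theta> v\<close> is the projection onto their right singular vectors.\<close>
  define \<theta> where "\<theta> j = (if d j \<le> \<epsilon> then 1 else 0::real)" for j
  define x where "x = P n b"
  define x'' where "x'' = sv_op k v \<theta> v x"
  have x: "x \<in> M n" and x'': "x'' \<in> M n"
    using sv_op_mem[OF v] by (simp_all add: x_def x''_def)
  have p_le: "p \<le> d j" if j: "j < k" and "\<not> d j \<le> \<epsilon>" for j
  proof -
    have "op_norm_on (M n) (mp_inverse_on (M n) (R \<epsilon> n)) =
        op_norm_on (M n) (sv_op k v (\<lambda>j. inverse (if d j \<le> \<epsilon> then 0 else d j)) u)"
      using R by (intro op_norm_mp_inverse_sv_op[OF u v]) simp
    then have "\<bar>inverse (d j)\<bar> < 1 / p"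
      using le_op_norm_sv_op[OF v u j, of "\<lambda>j. inverse (if d j \<le> \<epsilon> then 0 else d j)"] less that
      by simp
    then show ?thesis
      using p that \<epsilon> by (simp add: inverse_eq_divide field_simps)
  qed
  have norm_x'': "(norm x'')\<^sup>2 = (\<Sum>j<k. \<theta> j * (cmod (cinner (v j) x))\<^sup>2)"
    unfolding x''_def norm_sv_op[OF v] by (intro sum.cong) (auto simp: \<theta>_def)
  have "x'' \<bullet> x = x'' \<bullet> x''"
  proof -
    have "sv_op k v \<theta> v x'' = x''"
      unfolding x''_def sv_op_compose[OF v] by (intro fun_cong[OF sv_op_cong]) (simp add: \<theta>_def)
    then have "cinner x'' x'' = cinner x'' x"
      using sv_op_selfadjoint[of "M n" k v \<theta>] x x'' unfolding is_adjoint_on_def x''_def by metis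
    then show ?thesis
      by (metis Re_cinner)
  qed
  \<comment> \<open>As \<open>Q b = b\<close>, only \<open>Q x''\<close> pairs with
    \<open>b\<close>, and its norm is at most \<open>norm (T x'') / g\<close>. This is small since
    \<open>S n\<close> is bounded by \<open>\<eta>\<close> on \<open>x''\<close> and
    \<open>T\<close> differs from it by \<open>\<delta> n\<close>.\<close>
  then have "norm x'' * norm x'' = x'' \<bullet> b"
    using P_inner[of n x'' b] P_fix[OF x''] by (simp add: x_def dot_square_norm power2_eq_square)
  also have "\<dots> = Q x'' \<bullet> b"
    using Q_inner[of x'' b] b(1) by simp
  also have "\<dots> \<le> norm (Q x'')"
    using norm_cauchy_schwarz[of "Q x''" b] b(2) by simp
  also have "\<dots> \<le> norm (T x'') / g"
    using norm_Q_le[of x''] g_pos by (simp add: field_simps)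
  also have "\<dots> \<le> (\<eta> + \<delta> n) / g * norm x''"
  proof -
    have "(norm (S n x''))\<^sup>2 = (\<Sum>j<k. (d j * \<theta> j)\<^sup>2 * (cmod (cinner (v j) x))\<^sup>2)"
      using S x'' by (simp add: x''_def sv_op_compose[OF v] norm_sv_op[OF u])
    also have "\<dots> \<le> (\<Sum>j<k. \<eta>\<^sup>2 * (\<theta> j * (cmod (cinner (v j) x))\<^sup>2))"
    proof (intro sum_mono)
      fix j assume j: "j \<in> {..<k}"
      show "(d j * \<theta> j)\<^sup>2 * (cmod (cinner (v j) x))\<^sup>2 \<le> \<eta>\<^sup>2 * (\<theta> j * (cmod (cinner (v j) x))\<^sup>2)"
      proof (cases "d j \<le> \<epsilon>")
        case True
        \<comment> \<open>The gap pushes a discarded value from below \<open>\<epsilon>\<close> down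
          to below \<open>\<eta>\<close>.\<close>
        then have "d j \<le> \<eta>"
          using gap st j by fastforce
        then have "(d j)\<^sup>2 \<le> \<eta>\<^sup>2"
          using d j by (intro power_mono) auto
        then show ?thesis
          using True by (simp add: \<theta>_def mult_right_mono)
      qed (simp add: \<theta>_def)
    qed
    also have "\<dots> = (\<eta> * norm x'')\<^sup>2"
      by (simp add: power_mult_distrib norm_x'' sum_distrib_left)
    finally have "norm (S n x'') \<le> \<eta> * norm x''"
      by (rule power2_le_imp_le) (use \<eta> in simp)
    then have "norm (T x'') \<le> \<eta> * norm x'' + \<delta> n * norm x''"
      using norm_triangle_sub[of "T x''" "S n x''"] S_close[OF x''] by (simp add: norm_minus_commute)
    then show ?thesis
      using g_pos by (simp add: divide_right_mono flip: distrib_right)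
  qed
  finally have "norm x'' * norm x'' \<le> (\<eta> + \<delta> n) / g * norm x''" .
  then have "norm x'' \<le> (\<eta> + \<delta> n) / g"
  proof (cases "x'' = 0")
    case False
    show ?thesis
      by (rule mult_right_le_imp_le[OF \<open>norm x'' * norm x'' \<le> (\<eta> + \<delta> n) / g * norm x''\<close>])
        (use False in simp)
  qed (use \<eta> \<delta>_nonneg[of n] g_pos in simp)
  then have x''_le: "(norm x'')\<^sup>2 \<le> ((\<eta> + \<delta> n) / g)\<^sup>2"
    by (intro power_mono) auto
  have "p\<^sup>2 * ((norm x)\<^sup>2 - (norm x'')\<^sup>2) = (\<Sum>j<k. p\<^sup>2 * ((1 - \<theta> j) * (cmod (cinner (v j) x))\<^sup>2))"
    unfolding onb_parseval[OF v x] norm_x''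
    by (simp add: sum_distrib_left sum_subtractf left_diff_distrib right_diff_distrib)
  also have "\<dots> \<le> (\<Sum>j<k. (d j)\<^sup>2 * (cmod (cinner (v j) x))\<^sup>2)"
  proof (intro sum_mono)
    fix j assume j: "j \<in> {..<k}"
    show "p\<^sup>2 * ((1 - \<theta> j) * (cmod (cinner (v j) x))\<^sup>2) \<le> (d j)\<^sup>2 * (cmod (cinner (v j) x))\<^sup>2"
    proof (cases "d j \<le> \<epsilon>")
      case False
      then have "p\<^sup>2 \<le> (d j)\<^sup>2"
        using p_le j p by (intro power_mono) auto
      then show ?thesis
        using False by (simp add: \<theta>_def mult_right_mono)
    qed (simp add: \<theta>_def)
  qed
  also have "\<dots> = (norm (S n x))\<^sup>2"
    using S x by (simp add: norm_sv_op[OF u])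
  finally have "p\<^sup>2 * ((norm x)\<^sup>2 - (norm x'')\<^sup>2) \<le> (norm (S n x))\<^sup>2" .
  moreover have "p\<^sup>2 * ((norm x)\<^sup>2 - ((\<eta> + \<delta> n) / g)\<^sup>2) \<le> p\<^sup>2 * ((norm x)\<^sup>2 - (norm x'')\<^sup>2)"
    using x''_le by (intro mult_left_mono) auto
  ultimately show ?thesis
    unfolding x_def by linarith
qed

section \<open>Convergence of the norms of the regularizations and of their inverses\<close>

lemma op_norm_R_tendsto:
  assumes "0 < \<epsilon>" "\<epsilon> < g"
  shows "(\<lambda>n. op_norm_on (M n) (R \<epsilon> n)) \<longlonglongrightarrow> onorm T"
proof (rule Lim_transform_eventually[OF op_norm_S_tendsto])
  have "\<forall>\<^sub>F n in sequentially. \<epsilon> < op_norm_on (M n) (S n)"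
    using assms g_le_onorm by (intro order_tendstoD[OF op_norm_S_tendsto]) auto
  then show "\<forall>\<^sub>F n in sequentially. op_norm_on (M n) (S n) =
      op_norm_on (M n) (R \<epsilon> n)"
    by (rule eventually_mono) (simp add: op_norm_R_eq[OF assms(1)])
qed

lemma op_norm_R_mp_tendsto:
  assumes \<epsilon>: "0 < \<epsilon>" "\<epsilon> < g"
  shows "(\<lambda>n. op_norm_on (M n) (mp_inverse_on (M n) (R \<epsilon> n))) \<longlonglongrightarrow> onorm Y"
    (is "?f \<longlonglongrightarrow> _")
proof (rule order_tendstoI)
  fix a assume a: "onorm Y < a"
  then have "0 < a"
    using Y_norm_pos by linarith
  then have "max \<epsilon> (1 / a) < g"
    using a \<epsilon>(2) g_pos by (simp add: g_inverse field_simps)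
  then obtain \<gamma> where \<gamma>: "max \<epsilon> (1 / a) < \<gamma>" "\<gamma> < g"
    using dense by blast
  have "0 < \<gamma>"
    using \<gamma>(1) \<epsilon>(1) by simp
  have "1 / \<gamma> < a"
    using \<gamma>(1) \<open>0 < a\<close> \<open>0 < \<gamma>\<close> by (simp add: field_simps)
  from eventually_singular_value_gap[OF \<epsilon>(1) \<gamma>(2)]
  show "\<forall>\<^sub>F n in sequentially. ?f n < a"
  proof (rule eventually_mono)
    fix n assume "\<forall>u s v. singular_triple n u s v \<longrightarrow> s < \<epsilon> \<or> \<gamma> < s"
    then have "?f n \<le> 1 / \<gamma>"
      by (intro op_norm_R_mp_le[OF \<epsilon>(1) _ \<open>0 < \<gamma>\<close>]) fastforce
    with \<open>1 / \<gamma> < a\<close> show "?f n < a"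
      by linarith
  qed
next
  fix a assume "a < onorm Y"
  then have "max a 0 < onorm Y"
    using Y_norm_pos by simp
  then obtain c where c: "max a 0 < c" "c < onorm Y"
    using dense by blast
  define p where "p = 1 / c"
  have p: "0 < p" "1 / p = c"
    using c by (simp_all add: p_def)
  have "\<not> (\<forall>y. norm (Y y) \<le> c * norm y)"
    using onorm_bound[of c Y] c by auto
  then obtain y where y: "c * norm y < norm (Y y)"
    by (auto simp: not_le)
  then have Yy: "0 < norm (Y y)"
    using c(1) by (smt (verit) mult_nonneg_nonneg norm_ge_zero)
  \<comment> \<open>A normalised near-maximiser of \<open>Y\<close>: since \<open>T (Y y)\<close> is
    no longer than \<open>y\<close>, the norm of \<open>T b\<close> falls below
    \<open>1 / c = p\<close>.\<close>
  define b where "b = (1 / norm (Y y)) *\<^sub>R Y y"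
  have b: "Q b = b" "norm b = 1"
    using Yy by (simp_all add: b_def linear_scale[OF bounded_linear.linear[OF Q_lin]] QY)
  have "norm (T b) = norm (T (Y y)) / norm (Y y)"
    by (simp add: b_def T.scaleR)
  also have "\<dots> \<le> norm y / norm (Y y)"
    by (intro divide_right_mono norm_TY_le) simp
  also have "\<dots> < p"
    using y Yy c(1) by (simp add: p_def field_simps)
  finally have Tb: "(norm (T b))\<^sup>2 < p\<^sup>2"
    by (intro power_strict_mono) auto
  define \<kappa> where "\<kappa> = p\<^sup>2 - (norm (T b))\<^sup>2"
  \<comment> \<open>Makes \<open>p * (\<eta> / g)\<close> at most \<open>sqrt \<kappa> / 2\<close>,
    so the discarded components use up at most a quarter of the margin
    \<open>\<kappa>\<close>.\<close>
  define \<eta> where "\<eta> = min \<epsilon> (sqrt \<kappa> * g / (2 * p))"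
  have \<kappa>: "0 < \<kappa>"
    using Tb by (simp add: \<kappa>_def)
  have \<eta>: "0 < \<eta>" "\<eta> \<le> \<epsilon>"
    using \<kappa> \<epsilon>(1) g_pos p(1) by (simp_all add: \<eta>_def)
  have "(\<lambda>n. p\<^sup>2 * ((norm (P n b))\<^sup>2 - ((\<eta> + \<delta> n) / g)\<^sup>2) - (norm (S n (P n b)))\<^sup>2)
      \<longlonglongrightarrow> p\<^sup>2 * ((norm b)\<^sup>2 - ((\<eta> + 0) / g)\<^sup>2) - (norm (T b))\<^sup>2"
    using g_pos by (intro tendsto_intros P_tendsto S_tendsto comm) auto
  moreover have "0 < p\<^sup>2 * ((norm b)\<^sup>2 - ((\<eta> + 0) / g)\<^sup>2) - (norm (T b))\<^sup>2"
  proof -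
    have "p * (\<eta> / g) \<le> sqrt \<kappa> / 2"
      using p(1) g_pos by (simp add: \<eta>_def min_def field_simps)
    then have "(p * (\<eta> / g))\<^sup>2 \<le> (sqrt \<kappa> / 2)\<^sup>2"
      using p(1) \<eta>(1) g_pos by (intro power_mono) auto
    also have "\<dots> < \<kappa>"
      using \<kappa> by (simp add: power_divide)
    finally show ?thesis
      unfolding \<kappa>_def b(2) power_mult_distrib by (simp add: right_diff_distrib)
  qed
  ultimately have "\<forall>\<^sub>F n in sequentially.
      0 < p\<^sup>2 * ((norm (P n b))\<^sup>2 - ((\<eta> + \<delta> n) / g)\<^sup>2) - (norm (S n (P n b)))\<^sup>2"
    by (rule order_tendstoD)
  moreover have "\<forall>\<^sub>F n in sequentially. \<forall>u s v. singular_triple n u s v \<longrightarrow> s < \<eta> \<or> \<epsilon> < s"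
    by (rule eventually_singular_value_gap[OF \<eta>(1) \<epsilon>(2)])
  ultimately show "\<forall>\<^sub>F n in sequentially. a < ?f n"
  proof eventually_elim
    case (elim n)
    \<comment> \<open>A smaller value would force \<open>S n (P n b)\<close> to be longer than the
      strict inequality inherited from \<open>T b\<close> permits.\<close>
    have "\<not> ?f n < 1 / p"
      using op_norm_R_mp_small[OF \<epsilon>(1) _ \<eta>(1) p(1) _ b, of n] elim by fastforce
    then show ?case
      using c(1) p(2) by simp
  qed
qed

end

lemma (in asymptotically_commuting_filtration) generalized_cond_tendsto:
  assumes cl: "closed (range T)" and \<epsilon>: "0 < \<epsilon>"
    and less: "ereal \<epsilon> < Inf {ereal l | l. 0 < l \<and> complex_of_real (l ^ 2) \<in> op_spectrum (\<lambda>x. cadjoint T (T x))}"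
  shows "(\<lambda>n. op_norm_on (M n) (R \<epsilon> n) *
      op_norm_on (M n) (mp_inverse_on (M n) (R \<epsilon> n)))
    \<longlonglongrightarrow> onorm T * onorm (mp_inverse_on UNIV T)"
proof (cases "T = (\<lambda>x. 0)")
  case False
  then interpret closed_range_filtration T P
    by (intro closed_range_filtration.intro closed_range_filtration_axioms.intro
        asymptotically_commuting_filtration_axioms cl)
  show ?thesis
    using op_norm_R_tendsto[OF \<epsilon> less_g[OF less]] op_norm_R_mp_tendsto[OF \<epsilon> less_g[OF less]]
    unfolding Y_def by (rule tendsto_mult)
next
  case True
  then have T0: "onorm T = 0"
    by (simp add: onorm_zero)
  have "op_norm_on (M n) (R \<epsilon> n) = 0" for n
    using op_norm_R_le[OF \<epsilon>, of n] op_norm_R_nonneg[OF \<epsilon>, of n] op_norm_S_le[of n] by (simp add: T0)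
  then show ?thesis
    by (simp add: T0)
qed

theorem theorem3p4:
  fixes T :: "'a::chilbert_space \<Rightarrow> 'a"
    and P :: "nat \<Rightarrow> 'a \<Rightarrow> 'a"
  assumes "separable_space (euclidean :: 'a topology)"
    and "bounded_op_on UNIV T"
    and "quasidiagonal T"
    and "filtration P"
    and "(\<lambda>n. onorm (commutator (P n) T)) \<longlonglongrightarrow> 0"
  shows
    "((\<lambda>n. op_norm_on (range (P n)) (compression (P n) T)) \<longlonglongrightarrow> onorm T \<and>
      (\<lambda>n. inv_norm_on (range (P n)) (compression (P n) T)) \<longlonglongrightarrow> inv_norm_on UNIV T) \<and>
     (invertible_on UNIV T \<longrightarrow>
      (\<lambda>n. cond_on (range (P n)) (compression (P n) T)) \<longlonglongrightarrow> cond_on UNIV T) \<and>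
     (\<forall>\<epsilon>::real. closed (range T) \<and> 0 < \<epsilon> \<and>
        ereal \<epsilon> < Inf {ereal l | l. 0 < l \<and> complex_of_real (l ^ 2) \<in> op_spectrum (\<lambda>x. cadjoint T (T x))} \<longrightarrow>
      (\<lambda>n. let M = range (P n); R = regularization_on M \<epsilon> (compression (P n) T)
            in op_norm_on M R * op_norm_on M (mp_inverse_on M R))
        \<longlonglongrightarrow> onorm T * onorm (mp_inverse_on UNIV T))"
proof -
  interpret asymptotically_commuting_filtration T P
    using assms(2,4,5) by (rule asymptotically_commuting_filtration.intro)
  show ?thesis
    unfolding Let_def
    using op_norm_S_tendsto inv_norm_S_tendsto cond_S_tendsto generalized_cond_tendsto by blast
qed

end
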